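(* There exists a universal constant $C>0$ such that for any $1\le p<\infty$, any $\omega\in A_p^-(\mathbb{R})$ and any $u\in W^{1,p}(\mathbb{R},\omega)$, we have $$\sup_{0<\alpha<1}\left|\frac{1}{\Gamma(-\alpha)}\int_0^\infty\big(u(t-\tau)-u(t)\big)\frac{d\tau}{\tau^{1+\alpha}}\right|\le C\big(M^-(u')(t)+M^-u(t)\big)$$ for a.e. $t\in\mathbb{R}$.
   Context: $\Gamma$ is the Gamma function. One-sided maximal functions: $M^-u(t)=\sup_{h>0}\frac1h\int_{t-h}^t|u(\tau)|\,d\tau$ and $M^+u(t)=\sup_{h>0}\frac1h\int_t^{t+h}|u(\tau)|\,d\tau$. Left-sided Sawyer weights: a nonnegative locally integrable function $\omega$ on $\mathbb{R}$ belongs to $A_p^-(\mathbb{R})$, $1<p<\infty$, if there is $C>0$ with $$\Big(\frac1h\int_a^{a+h}\omega\,d\tau\Big)^{1/p}\Big(\frac1h\int_{a-h}^a\omega^{1-p'}\,d\tau\Big)^{1/p'}\le C\quad\text{for all }a\in\mathbb{R},\ h>0,$$ where $1/p+1/p'=1$; $\omega\in A_1^-(\mathbb{R})$ if there is $C>0$ with $M^+\omega(t)\le C\omega(t)$ for a.e. $t\in\mathbb{R}$. Weights are assumed to satisfy $0<\omega<\infty$ in $\mathbb{R}$. $L^p(\mathbb{R},\omega)$ is the $L^p$ space with respect to $\omega(t)\,dt$, and $W^{1,p}(\mathbb{R},\omega)=\{u\in L^p(\mathbb{R},\omega):u'\in L^p(\mathbb{R},\omega)\}$, with $u'$ the distributional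 derivative. *)

theory Defs
  imports "HOL-Analysis.Analysis"
begin

text \<open>
  Functions on the line are Lebesgue measurable representatives of their almost-everywhere
  classes; all measures and integrals refer to \<open>lebesgue\<close>, the completion of \<open>lborel\<close>.
\<close>

definition locally_integrable :: "(real \<Rightarrow> real) \<Rightarrow> bool" where
  "locally_integrable f \<longleftrightarrow> (\<forall>a b. f absolutely_integrable_on {a..b})"

text \<open>The one-sided maximal functions may be infinite, hence take values in \<open>ennreal\<close>.\<close>

definition maximal_minus :: "(real \<Rightarrow> real) \<Rightarrow> real \<Rightarrow> ennreal" where
  "maximal_minus u t =
     (SUP h\<in>{0<..}. ennreal (1 / h) * (\<integral>\<^sup>+\<tau>\<in>{t - h..t}. ennreal \<bar>u \<tau>\<bar> \<partial>lebesgue))"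

definition maximal_plus :: "(real \<Rightarrow> real) \<Rightarrow> real \<Rightarrow> ennreal" where
  "maximal_plus u t =
     (SUP h\<in>{0<..}. ennreal (1 / h) * (\<integral>\<^sup>+\<tau>\<in>{t..t + h}. ennreal \<bar>u \<tau>\<bar> \<partial>lebesgue))"

definition conjugate_exponent :: "real \<Rightarrow> real" where
  "conjugate_exponent p = p / (p - 1)"

definition weight :: "(real \<Rightarrow> real) \<Rightarrow> bool" where
  "weight \<omega> \<longleftrightarrow> locally_integrable \<omega> \<and> (\<forall>t. 0 < \<omega> t)"

text \<open>
  For \<open>p > 1\<close> the integral of the power with exponent \<open>1 - p'\<close> is a priori an extended real. Since
  the average of \<open>\<omega>\<close> is positive, a finite bound forces it to be finite; with real-valued
  integrals, this has to be said explicitly by requiring that power to be locally integrable.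
\<close>

definition sawyer_minus :: "real \<Rightarrow> (real \<Rightarrow> real) set" where
  "sawyer_minus p =
     {\<omega>. weight \<omega> \<and>
        (if p = 1
         then \<exists>C>0. AE t in lebesgue. maximal_plus \<omega> t \<le> ennreal (C * \<omega> t)
         else let q = conjugate_exponent p in
           locally_integrable (\<lambda>\<tau>. \<omega> \<tau> powr (1 - q)) \<and>
           (\<exists>C>0. \<forall>a. \<forall>h>0.
              (1 / h * (LINT \<tau>:{a..a + h}|lebesgue. \<omega> \<tau>)) powr (1 / p) *
              (1 / h * (LINT \<tau>:{a - h..a}|lebesgue. \<omega> \<tau> powr (1 - q))) powr (1 / q) \<le> C))}"

definition weighted_Lp :: "real \<Rightarrow> (real \<Rightarrow> real) \<Rightarrow> (real \<Rightarrow> real) set" where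
  "weighted_Lp p \<omega> =
     {u. u \<in> borel_measurable lebesgue \<and> integrable lebesgue (\<lambda>t. \<bar>u t\<bar> powr p * \<omega> t)}"

definition test_function :: "(real \<Rightarrow> real) \<Rightarrow> bool" where
  "test_function \<phi> \<longleftrightarrow>
     (\<forall>n x. (deriv ^^ n) \<phi> field_differentiable at x) \<and> compact (closure {x. \<phi> x \<noteq> 0})"

definition distributional_derivative :: "(real \<Rightarrow> real) \<Rightarrow> (real \<Rightarrow> real) \<Rightarrow> bool" where
  "distributional_derivative u v \<longleftrightarrow>
     locally_integrable u \<and> locally_integrable v \<and>
     (\<forall>\<phi>. test_function \<phi> \<longrightarrow>
        (LINT t|lebesgue. u t * deriv \<phi> t) = - (LINT t|lebesgue. v t * \<phi> t))"

definition weighted_W1p :: "real \<Rightarrow> (real \<Rightarrow> real) \<Rightarrow> (real \<Rightarrow> real) set" where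
  "weighted_W1p p \<omega> =
     {u \<in> weighted_Lp p \<omega>. \<exists>v\<in>weighted_Lp p \<omega>. distributional_derivative u v}"

end

theory Submission
  imports Defs
begin

text \<open>
  The estimate is pointwise and holds at almost every \<open>t\<close>; the weight enters only through the
  convergence of the integral at infinity.

  A function \<open>u\<close> with weak derivative \<open>u'\<close> agrees almost everywhere with a continuous \<open>U\<close> whose
  increments are integrals of \<open>u'\<close> (\<open>continuous_representative\<close>). Write \<open>M\<close> and \<open>N\<close> for the values
  at \<open>t\<close> of the left maximal functions of \<open>u'\<close> and \<open>u\<close>, and suppose that both are finite. On
  \<open>0 < \<tau> \<le> 1\<close> the increment satisfies \<open>\<bar>U (t - \<tau>) - U t\<bar> \<le> M * \<tau>\<close>, so this part of the integral is
  at most \<open>M / (1 - \<alpha>)\<close>. On \<open>\<tau> > 1\<close> the two terms are estimated separately: \<open>\<bar>U t\<bar> \<le> N\<close> by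
  continuity, and writing \<open>\<tau> powr (- 1 - \<alpha>)\<close> as the integral of its own derivative over \<open>[\<tau>, \<infinity>)\<close>
  turns \<open>\<bar>U (t - \<tau>)\<bar>\<close> into its averages over \<open>[t - s, t]\<close>; together they give at most
  \<open>N * (2 + \<alpha>) / \<alpha>\<close> (\<open>pointwise_estimate\<close>). The poles at \<open>\<alpha> = 0\<close> and \<open>\<alpha> = 1\<close> are exactly
  cancelled by the zeros of \<open>1 / Gamma (- \<alpha>) = - \<alpha> * (1 - \<alpha>) / Gamma (2 - \<alpha>)\<close>, which leaves a
  constant that depends neither on \<open>\<alpha>\<close> nor on \<open>p\<close>, the weight or the function
  (\<open>inverse_Gamma_bound\<close>).

  The integral also has to converge where one of the maximal functions is infinite. Near \<open>\<tau> = 0\<close>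
  this follows, for almost every \<open>t\<close>, from Tonelli's theorem: the integral of
  \<open>\<bar>U (t - \<tau>) - U t\<bar>\<close> over a bounded interval of \<open>t\<close> is \<open>O(\<tau>)\<close> (\<open>AE_near_zero_finite\<close>). At infinity it
  follows, for every \<open>t\<close>, from the Sawyer condition, which bounds the integral of \<open>\<bar>u\<bar>\<close> over
  \<open>[t - h, t]\<close> linearly in \<open>h \<ge> 1\<close> (\<open>weighted_Lp_linear_growth\<close>).
\<close>

section \<open>Smooth bump functions\<close>

text \<open>
  The iterated derivatives of \<open>flat 0\<close>, the standard smooth function that is flat at \<open>0\<close>, are linear
  combinations of these functions.
\<close>

definition flat :: "nat \<Rightarrow> real \<Rightarrow> real" where
  "flat k x = (if x > 0 then exp (- 1 / x) / x ^ k else 0)"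

lemma flat_at_right_0: "((\<lambda>x::real. exp (- 1 / x) / x ^ k) \<longlongrightarrow> 0) (at_right 0)"
proof -
  have "((\<lambda>y::real. y ^ k / exp y) \<longlongrightarrow> 0) at_top"
    by (rule tendsto_power_div_exp_0)
  then have "((\<lambda>x::real. inverse x ^ k / exp (inverse x)) \<longlongrightarrow> 0) (at_right 0)"
    by (rule filterlim_compose[OF _ filterlim_inverse_at_top_right])
  then show ?thesis
    by (simp add: exp_minus field_simps)
qed

text \<open>
  At \<open>0\<close> the difference quotient of \<open>flat k\<close> is \<open>flat (Suc k)\<close>, so it tends to \<open>0\<close> as well.
\<close>

lemma DERIV_flat: "(flat k has_real_derivative (flat (k + 2) x - real k * flat (k + 1) x)) (at x)"
proof (cases x "0::real" rule: linorder_cases)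
  case less
  have "((\<lambda>x. 0) has_real_derivative 0) (at x)" by simp
  then have "(flat k has_real_derivative 0) (at x)"
    by (rule has_field_derivative_transform_within_open[of _ _ _ "{..<0}"])
      (use less in \<open>auto simp: flat_def\<close>)
  then show ?thesis using less by (simp add: flat_def)
next
  case greater
  have eq: "exp (- 1 / x) * (1 / x^2) / x ^ k - exp (- 1 / x) * (real k * x ^ (k - 1)) / (x ^ k * x ^ k)
      = flat (k + 2) x - real k * flat (k + 1) x"
    using greater by (cases k) (auto simp: flat_def field_simps power2_eq_square)
  have "((\<lambda>x. exp (- 1 / x) / x ^ k) has_real_derivative
      (flat (k + 2) x - real k * flat (k + 1) x)) (at x)"
    unfolding eq[symmetric]
    by (rule derivative_eq_intros refl | use greater in \<open>simp add: field_simps power2_eq_square\<close>)+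
  then show ?thesis
    by (rule has_field_derivative_transform_within_open[of _ _ _ "{0<..}"])
      (use greater in \<open>auto simp: flat_def\<close>)
next
  case equal
  have "((\<lambda>y. (flat k y - flat k 0) / (y - 0)) \<longlongrightarrow> 0) (at 0)"
  proof (rule filterlim_split_at)
    show "((\<lambda>y. (flat k y - flat k 0) / (y - 0)) \<longlongrightarrow> 0) (at_left 0)"
      by (rule tendsto_eventually) (auto simp: flat_def eventually_at_filter)
    show "((\<lambda>y. (flat k y - flat k 0) / (y - 0)) \<longlongrightarrow> 0) (at_right 0)"
      by (rule Lim_transform_eventually[OF flat_at_right_0[of "Suc k"]])
        (auto simp: flat_def eventually_at_filter field_simps)
  qed
  then show ?thesis
    using equal by (simp add: has_field_derivative_iff flat_def)
qed

text \<open>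
  An algebra of functions that is closed under differentiation consists of smooth functions. Proving
  closure for the one generated by the rescaled \<open>flat k\<close> avoids any formula for the higher
  derivatives of a product.
\<close>

inductive flat_algebra :: "(real \<Rightarrow> real) \<Rightarrow> bool" where
  gen: "flat_algebra (\<lambda>x. flat k (c * x + d))"
| const: "flat_algebra (\<lambda>x. c)"
| add: "flat_algebra f \<Longrightarrow> flat_algebra g \<Longrightarrow> flat_algebra (\<lambda>x. f x + g x)"
| mult: "flat_algebra f \<Longrightarrow> flat_algebra g \<Longrightarrow> flat_algebra (\<lambda>x. f x * g x)"

lemma flat_algebra_derivative:
  assumes "flat_algebra f"
  obtains f' where "flat_algebra f'" "\<And>x. (f has_real_derivative f' x) (at x)"
  using assms
proof (induction arbitrary: thesis)
  case (gen k c d)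
  show ?case
  proof (rule gen)
    show "flat_algebra (\<lambda>x. c * (flat (k + 2) (c * x + d) + (- real k) * flat (k + 1) (c * x + d)))"
      by (intro flat_algebra.intros)
    show "((\<lambda>x. flat k (c * x + d)) has_real_derivative
        c * (flat (k + 2) (c * x + d) + (- real k) * flat (k + 1) (c * x + d))) (at x)" for x
    proof -
      have "((\<lambda>x. c * x + d) has_real_derivative c) (at x)"
        by (auto intro!: derivative_eq_intros)
      from DERIV_chain2[OF DERIV_flat this, of k] show ?thesis
        by (simp add: mult.commute)
    qed
  qed
next
  case (const c)
  show ?case by (rule const[OF flat_algebra.const[of 0]]) simp
next
  case (add f g)
  obtain f' g' where "flat_algebra f'" "\<And>x. (f has_real_derivative f' x) (at x)"
    "flat_algebra g'" "\<And>x. (g has_real_derivative g' x) (at x)"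
    using add.IH by metis
  then show ?case
    by (intro add.prems[of "\<lambda>x. f' x + g' x"]) (auto intro!: flat_algebra.intros derivative_intros)
next
  case (mult f g)
  obtain f' g' where "flat_algebra f'" "\<And>x. (f has_real_derivative f' x) (at x)"
    "flat_algebra g'" "\<And>x. (g has_real_derivative g' x) (at x)"
    using mult.IH by metis
  then show ?case
    by (intro mult.prems[of "\<lambda>x. f' x * g x + g' x * f x"])
      (auto intro!: flat_algebra.intros DERIV_mult mult.hyps)
qed

lemma flat_algebra_deriv: "flat_algebra f \<Longrightarrow> flat_algebra (deriv f)"
  by (metis DERIV_imp_deriv ext flat_algebra_derivative)

lemma flat_algebra_deriv_funpow: "flat_algebra f \<Longrightarrow> flat_algebra ((deriv ^^ n) f)"
  by (induction n) (auto intro: flat_algebra_deriv)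

lemma flat_algebra_continuous_on: "flat_algebra f \<Longrightarrow> continuous_on A f"
  by (meson DERIV_isCont continuous_at_imp_continuous_on flat_algebra_derivative)

text \<open>
  Only the derivative has to lie in \<open>flat_algebra\<close>: the test functions needed below are primitives of
  elements of this algebra, and the primitives themselves lie outside it.
\<close>

lemma test_function_antiderivative:
  assumes "flat_algebra \<psi>" and \<phi>: "\<And>x. (\<phi> has_real_derivative \<psi> x) (at x)"
    and supp: "\<And>x. x \<notin> {a..b} \<Longrightarrow> \<phi> x = 0"
  shows "test_function \<phi>"
  unfolding test_function_def
proof (intro conjI allI)
  fix n x
  have "deriv \<phi> = \<psi>" using \<phi> by (auto intro: DERIV_imp_deriv)
  moreover have "(deriv ^^ m) \<psi> field_differentiable at x" for m
    using flat_algebra_deriv_funpow[OF assms(1), of m]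
    by (metis flat_algebra_derivative field_differentiable_def)
  moreover have "\<phi> field_differentiable at x"
    using \<phi> field_differentiable_def by blast
  ultimately show "(deriv ^^ n) \<phi> field_differentiable at x"
    by (cases n) (auto simp: funpow_Suc_right simp del: funpow.simps)
next
  have "{x. \<phi> x \<noteq> 0} \<subseteq> {a..b}" using supp by blast
  then have "closure {x. \<phi> x \<noteq> 0} \<subseteq> {a..b}" by (simp add: closure_minimal)
  then show "compact (closure {x. \<phi> x \<noteq> 0})"
    by (metis closed_closure compact_Icc compact_Int_closed inf.absorb_iff2)
qed

text \<open>
  Inside \<open>(a, b)\<close> both arguments tend to infinity with \<open>n\<close>, where \<open>flat 0\<close> tends to \<open>1\<close>; outside,
  one of them is nonpositive for every \<open>n\<close>. Hence these functions approximate the indicator of \<open>(a, b)\<close> with a fixed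
  support.
\<close>

definition bump :: "nat \<Rightarrow> real \<Rightarrow> real \<Rightarrow> real \<Rightarrow> real" where
  "bump n a b x = flat 0 (real n * (x - a)) * flat 0 (real n * (b - x))"

lemma flat_algebra_bump: "flat_algebra (bump n a b)"
proof -
  have "bump n a b = (\<lambda>x. flat 0 (real n * x + - (real n * a)) * flat 0 ((- real n) * x + real n * b))"
    by (auto simp: bump_def algebra_simps)
  then show ?thesis by (simp only: flat_algebra.intros)
qed

lemma bump_bounds: "0 \<le> bump n a b x" "bump n a b x \<le> indicator {a..b} x"
proof -
  have f: "0 \<le> flat 0 y" "flat 0 y \<le> 1" for y by (auto simp: flat_def)
  show "0 \<le> bump n a b x" by (simp add: bump_def f)
  have "bump n a b x \<le> 1" unfolding bump_def using mult_mono[OF f(2) f(2), OF _ f(1)] by simp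
  moreover have "bump n a b x = 0" if "x \<notin> {a..b}"
  proof -
    have "real n * (x - a) \<le> 0 \<or> real n * (b - x) \<le> 0"
      using that by (auto simp: mult_le_0_iff)
    then show ?thesis by (auto simp: bump_def flat_def)
  qed
  ultimately show "bump n a b x \<le> indicator {a..b} x" by (auto simp: indicator_def)
qed

lemma bump_tendsto: "(\<lambda>n. bump n a b x) \<longlonglongrightarrow> indicator {a<..<b} x"
proof (cases "x \<in> {a<..<b}")
  case True
  have "(\<lambda>n. flat 0 (real n * c)) \<longlonglongrightarrow> 1" if "c > 0" for c
  proof -
    have "(\<lambda>n. exp (- (1 / c) * inverse (real n))) \<longlonglongrightarrow> exp (- (1 / c) * 0)"
      by (intro tendsto_intros lim_inverse_n)
    then have "(\<lambda>n. exp (- (1 / c) * inverse (real n))) \<longlonglongrightarrow> 1" by simp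
    then show ?thesis
      by (rule Lim_transform_eventually)
         (use that in \<open>auto simp: flat_def field_simps intro!: eventually_sequentiallyI[of 1]\<close>)
  qed
  from tendsto_mult[OF this this, of "x - a" "b - x"] True show ?thesis
    by (simp add: bump_def)
next
  case False
  have "bump n a b x = 0" for n
  proof -
    have "real n * (x - a) \<le> 0 \<or> real n * (b - x) \<le> 0"
      using False by (auto simp: mult_le_0_iff)
    then show ?thesis by (auto simp: bump_def flat_def)
  qed
  with False show ?thesis by simp
qed

section \<open>Functions with a weak derivative\<close>

text \<open>
  On a bounded interval the positive and the negative part of \<open>w\<close> are densities of two finite measures
  that agree on all half-lines. These measures are therefore equal, and so are their densities.
\<close>

lemma AE_zero_if_interval_integrals_zero:
  fixes w :: "real \<Rightarrow> real"
  assumes [measurable]: "w \<in> borel_measurable borel"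
    and int: "\<And>a b. set_integrable lborel {a..b} w"
    and zero: "\<And>a b. integral {a..b} w = 0"
  shows "AE x in lborel. w x = 0"
proof -
  have box: "AE x in lborel. x \<in> {- real n..real n} \<longrightarrow> w x = 0" for n
  proof -
    define G where "G x = indicator {- real n..real n} x * w x" for x
    have [measurable]: "G \<in> borel_measurable borel" unfolding G_def by simp
    have G: "integrable lborel G"
      using int[of "- real n" "real n"] unfolding set_integrable_def G_def by simp
    have *: "emeasure (density lborel (\<lambda>y. ennreal (G y))) {x<..} < \<infinity> \<and>
        emeasure (density lborel (\<lambda>y. ennreal (G y))) {x<..}
        = emeasure (density lborel (\<lambda>y. ennreal (- G y))) {x<..}" for x
    proof -
      define H where "H y = indicator {x<..} y * G y" for y
      have H: "integrable lborel H"
        unfolding H_def using integrable_mult_indicator[OF _ G, of "{x<..}"] by simp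
      have "(LINT y|lborel. H y) = (LINT y:{max x (- real n)..real n}|lborel. w y)"
        unfolding set_lebesgue_integral_def H_def G_def
        by (rule integral_cong_AE; (measurable)?)
          (use AE_lborel_singleton[of x] in eventually_elim, auto simp: indicator_def)
      also have "\<dots> = 0"
        using set_borel_integral_eq_integral(2)[OF int] zero by simp
      finally have z: "(LINT y|lborel. H y) = 0" .
      have fin: "(\<integral>\<^sup>+y. ennreal (H y) \<partial>lborel) \<noteq> \<infinity>" "(\<integral>\<^sup>+y. ennreal (- H y) \<partial>lborel) \<noteq> \<infinity>"
        using H by (auto simp: real_integrable_def)
      have "enn2real (\<integral>\<^sup>+y. ennreal (H y) \<partial>lborel) = enn2real (\<integral>\<^sup>+y. ennreal (- H y) \<partial>lborel)"
        using real_lebesgue_integral_def[OF H] z by simp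
      then have eq: "(\<integral>\<^sup>+y. ennreal (H y) \<partial>lborel) = (\<integral>\<^sup>+y. ennreal (- H y) \<partial>lborel)"
        using fin by (metis ennreal_enn2real_if infinity_ennreal_def)
      have "emeasure (density lborel (\<lambda>y. ennreal (G y))) {x<..} = (\<integral>\<^sup>+y. ennreal (H y) \<partial>lborel)"
        "emeasure (density lborel (\<lambda>y. ennreal (- G y))) {x<..} = (\<integral>\<^sup>+y. ennreal (- H y) \<partial>lborel)"
        by (simp_all add: emeasure_density H_def)
          (auto intro!: nn_integral_cong simp: indicator_def)
      with eq fin show ?thesis by (simp add: less_top)
    qed
    have "density lborel (\<lambda>y. ennreal (G y)) = density lborel (\<lambda>y. ennreal (- G y))"
      by (rule measure_eqI_lessThan[OF _ _ conjunct1[OF *] conjunct2[OF *]]) simp_all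
    then have "AE x in lborel. ennreal (G x) = ennreal (- G x)"
      by (intro sigma_finite_measure.density_unique[OF sigma_finite_lborel]) auto
    then show ?thesis
    proof eventually_elim
      case (elim x)
      then have "G x = 0"
        by (metis ennreal_eq_0_iff ennreal_neg linorder_linear neg_0_le_iff_le neg_le_0_iff_le antisym)
      then show ?case by (auto simp: G_def indicator_def)
    qed
  qed
  have "AE x in lborel. \<forall>n. x \<in> {- real n..real n} \<longrightarrow> w x = 0"
    unfolding AE_all_countable using box by blast
  then show ?thesis
  proof eventually_elim
    case (elim x)
    obtain n where "\<bar>x\<bar> \<le> real n" using real_arch_simple by blast
    with elim show ?case by (auto simp: abs_le_iff)
  qed
qed

lemma bump_integral_tendsto:
  fixes w :: "real \<Rightarrow> real"
  assumes [measurable]: "w \<in> borel_measurable borel" and int: "set_integrable lborel {a..b} w"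
  shows "(\<lambda>n. LINT x|lborel. w x * bump n a b x) \<longlonglongrightarrow> integral {a..b} w"
    and "integrable lborel (\<lambda>x. w x * bump n a b x)"
proof -
  have [measurable]: "bump n a b \<in> borel_measurable borel" for n
    by (rule borel_measurable_continuous_onI[OF flat_algebra_continuous_on[OF flat_algebra_bump]])
  have dom: "integrable lborel (\<lambda>x. indicator {a..b} x * \<bar>w x\<bar>)"
    using set_integrable_abs[OF int] by (simp add: set_integrable_def)
  have bd: "norm (w x * bump n a b x) \<le> indicator {a..b} x * \<bar>w x\<bar>" for n x
    using bump_bounds[of n a b x] by (simp add: abs_mult mult_left_mono mult.commute)
  show "integrable lborel (\<lambda>x. w x * bump n a b x)"
    by (rule Bochner_Integration.integrable_bound[OF dom])
      (use bd in \<open>auto intro!: AE_I2 order_trans[OF bd]\<close>)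
  have "(\<lambda>n. LINT x|lborel. w x * bump n a b x) \<longlonglongrightarrow> (LINT x|lborel. w x * indicator {a<..<b} x)"
    by (rule integral_dominated_convergence[OF _ _ dom])
      (use bd in \<open>auto intro!: tendsto_intros bump_tendsto\<close>)
  also have "(LINT x|lborel. w x * indicator {a<..<b} x) = (LINT x:{a..b}|lborel. w x)"
    unfolding set_lebesgue_integral_def
    by (rule integral_cong_AE; (measurable)?)
      (use AE_lborel_singleton[of a] AE_lborel_singleton[of b] in eventually_elim, auto simp: indicator_def)
  also have "\<dots> = integral {a..b} w" by (rule set_borel_integral_eq_integral(2)[OF int])
  finally show "(\<lambda>n. LINT x|lborel. w x * bump n a b x) \<longlonglongrightarrow> integral {a..b} w" .
qed

text \<open>
  The test functions are combinations of two bumps, over \<open>(a, b)\<close> and over \<open>(0, 1)\<close>, with the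
  coefficients that make the mean vanish. In the limit orthogonality says that the mean of \<open>w\<close> over
  \<open>[a, b]\<close> equals its mean over \<open>[0, 1]\<close>.
\<close>

lemma du_Bois_Reymond:
  fixes w :: "real \<Rightarrow> real"
  assumes [measurable]: "w \<in> borel_measurable borel"
    and int: "\<And>a b. set_integrable lborel {a..b} w"
    and orth: "\<And>\<psi> a b. a \<le> b \<Longrightarrow> flat_algebra \<psi> \<Longrightarrow> (\<And>x. x \<notin> {a..b} \<Longrightarrow> \<psi> x = 0)
      \<Longrightarrow> (LINT x|lborel. \<psi> x) = 0 \<Longrightarrow> (LINT x|lborel. w x * \<psi> x) = 0"
  shows "AE x in lborel. w x = integral {0..1} w"
proof -
  define c where "c = integral {0..1} w"
  have one: "set_integrable lborel {a..b} (\<lambda>x::real. 1::real)" for a b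
    by (intro borel_integrable_atLeastAtMost' continuous_intros)
  have lin: "integral {a..b} w = (b - a) * c" if "a \<le> b" for a b
  proof -
    define r where "r n = (LINT x|lborel. bump n a b x)" for n
    define s where "s n = (LINT x|lborel. bump n 0 1 x)" for n
    define p where "p n = (LINT x|lborel. w x * bump n a b x)" for n
    define q where "q n = (LINT x|lborel. w x * bump n 0 1 x)" for n
    have "s n * p n - r n * q n = 0" for n
    proof -
      note i1 = bump_integral_tendsto(2)[OF _ one, simplified]
      note i2 = bump_integral_tendsto(2)[OF assms(1) int]
      (* the weights s n and r n are the masses of the opposite bumps, so that the mean vanishes *)
      define \<psi> where "\<psi> x = s n * bump n a b x + (- r n) * bump n 0 1 x" for x
      have "(LINT x|lborel. w x * \<psi> x) = 0"
      proof (rule orth[of "min a 0" "max b 1"])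
        show "flat_algebra \<psi>"
          unfolding \<psi>_def by (intro flat_algebra.intros flat_algebra_bump[unfolded eta_contract_eq])
        show "\<psi> x = 0" if "x \<notin> {min a 0..max b 1}" for x
        proof -
          have "x \<notin> {a..b}" "x \<notin> {0..1}" using that by auto
          then have "bump n a b x = 0" "bump n 0 1 x = 0"
            using bump_bounds[of n a b x] bump_bounds[of n 0 1 x] by simp_all
          then show ?thesis by (simp add: \<psi>_def)
        qed
        show "(LINT x|lborel. \<psi> x) = 0"
          unfolding \<psi>_def using i1 by (simp add: r_def s_def)
      qed auto
      also have "(\<lambda>x. w x * \<psi> x) = (\<lambda>x. s n * (w x * bump n a b x) - r n * (w x * bump n 0 1 x))"
        by (auto simp: \<psi>_def algebra_simps)
      also have "(LINT x|lborel. s n * (w x * bump n a b x) - r n * (w x * bump n 0 1 x))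
          = s n * p n - r n * q n"
        using i2 by (simp add: p_def q_def)
      finally show ?thesis .
    qed
    moreover have "(\<lambda>n. s n * p n - r n * q n) \<longlonglongrightarrow> (1 - 0) * integral {a..b} w - (b - a) * c"
    proof (intro tendsto_intros)
      show "p \<longlonglongrightarrow> integral {a..b} w" "q \<longlonglongrightarrow> c"
        unfolding p_def q_def c_def by (intro bump_integral_tendsto int assms)+
      show "r \<longlonglongrightarrow> b - a" "s \<longlonglongrightarrow> 1 - 0"
        unfolding r_def s_def
        using bump_integral_tendsto(1)[OF _ one, of a b] bump_integral_tendsto(1)[OF _ one, of 0 1] that
        by simp_all
    qed
    ultimately have "(\<lambda>n. 0) \<longlonglongrightarrow> (1 - 0) * integral {a..b} w - (b - a) * c"
      by simp
    from LIMSEQ_unique[OF this tendsto_const] show ?thesis by simp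
  qed
  have "AE x in lborel. w x - c = 0"
  proof (rule AE_zero_if_interval_integrals_zero)
    show "set_integrable lborel {a..b} (\<lambda>x. w x - c)" for a b
      by (rule set_integral_diff(1)[OF int]) (intro borel_integrable_atLeastAtMost' continuous_intros)
    show "integral {a..b} (\<lambda>x. w x - c) = 0" for a b
    proof (cases "a \<le> b")
      case True
      then show ?thesis
        using lin[OF True] set_borel_integral_eq_integral(1)[OF int, of a b]
        by (subst Henstock_Kurzweil_Integration.integral_diff) (auto intro: integrable_const_ivl)
    qed simp
  qed simp
  then show ?thesis unfolding c_def by simp
qed

definition primitive :: "(real \<Rightarrow> real) \<Rightarrow> real \<Rightarrow> real" where
  "primitive v x = (if 0 \<le> x then integral {0..x} v else - integral {x..0} v)"

lemma primitive_diff: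
  assumes int: "\<And>a b. v integrable_on {a..b}" and "x \<le> y"
  shows "primitive v y - primitive v x = integral {x..y} v"
proof -
  note comb = Henstock_Kurzweil_Integration.integral_combine[OF _ _ int]
  consider "0 \<le> x" | "x < 0" "0 \<le> y" | "y < 0" by linarith
  then show ?thesis
  proof cases
    case 1 then show ?thesis using comb[of 0 x y] \<open>x \<le> y\<close> by (simp add: primitive_def)
  next
    case 2 then show ?thesis using comb[of x 0 y] by (simp add: primitive_def)
  next
    case 3 then show ?thesis using comb[of x y 0] \<open>x \<le> y\<close> by (simp add: primitive_def)
  qed
qed

lemma continuous_on_primitive:
  assumes int: "\<And>a b. v integrable_on {a..b}"
  shows "continuous_on UNIV (primitive v)"
proof (rule continuous_at_imp_continuous_on, safe)
  fix x :: real
  have "continuous_on {x - 1..x + 1} (\<lambda>y. primitive v (x - 1) + integral {x - 1..y} v)"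
    by (intro continuous_intros indefinite_integral_continuous_1 int)
  moreover have "primitive v (x - 1) + integral {x - 1..y} v = primitive v y" if "y \<in> {x - 1..x + 1}" for y
    using primitive_diff[OF int, of "x - 1" y] that by auto
  ultimately have "continuous_on {x - 1..x + 1} (primitive v)"
    by (rule continuous_on_eq)
  then show "isCont (primitive v) x"
    by (rule continuous_on_interior) simp
qed

text \<open>
  The primitive of \<open>v\<close> need not be differentiable at every point, so the product rule is replaced by
  Fubini's theorem on the triangle \<open>a \<le> s \<le> x \<le> b\<close>. Since \<open>\<psi>\<close> has mean zero, the integral of \<open>\<psi>\<close>
  over \<open>[s, b]\<close> is minus the integral over \<open>[a, s]\<close>, and the value of the primitive at \<open>a\<close> drops out.
\<close>

lemma primitive_integration_by_parts:
  fixes v \<psi> :: "real \<Rightarrow> real"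
  assumes [measurable]: "v \<in> borel_measurable borel"
    and int: "\<And>a b. set_integrable lborel {a..b} v"
    and "a \<le> b" and cont: "continuous_on UNIV \<psi>"
    and supp: "\<And>x. x \<notin> {a..b} \<Longrightarrow> \<psi> x = 0" and mean: "integral {a..b} \<psi> = 0"
  shows "(LINT x|lborel. primitive v x * \<psi> x) = - (LINT x|lborel. v x * (indicator {a..b} x * integral {a..x} \<psi>))"
proof -
  have cont_ab: "continuous_on {c..d} \<psi>" for c d
    using cont continuous_on_subset by blast
  have [measurable]: "\<psi> \<in> borel_measurable borel"
    by (rule borel_measurable_continuous_onI[OF cont])
  note hk = set_borel_integral_eq_integral[OF int]
  have \<psi>int: "set_integrable lborel {c..d} \<psi>" for c d
    by (rule borel_integrable_atLeastAtMost'[OF cont_ab])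
  (* the kernel supported on the triangle a <= s <= x <= b *)
  define K where "K x s = (indicator {a..b} x * \<psi> x) * (indicator {a..b} s * v s) * of_bool (s \<le> x)" for x s
  have Kmeas: "(\<lambda>(x, s). K x s) \<in> borel_measurable (lborel \<Otimes>\<^sub>M lborel)"
    unfolding K_def by measurable
  have v1: "integrable lborel (\<lambda>s. indicator {a..b} s * v s)"
    using int[of a b] by (simp add: set_integrable_def)
  have \<psi>1: "integrable lborel (\<lambda>s. indicator {a..b} s * \<psi> s)"
    using \<psi>int[of a b] by (simp add: set_integrable_def)
  have Km: "K x \<in> borel_measurable lborel" for x
    unfolding K_def by measurable
  have Kx: "integrable lborel (K x)" for x
    using Km[of x] by (rule Bochner_Integration.integrable_bound[OF integrable_mult_right[OF v1, of "indicator {a..b} x * \<psi> x"]])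
      (auto simp: K_def[abs_def] abs_mult)
  have "integrable (lborel \<Otimes>\<^sub>M lborel) (\<lambda>(x, s). K x s)"
  proof (rule lborel_pair.Fubini_integrable[OF Kmeas])
    show "AE x in lborel. integrable lborel (\<lambda>y. case (x, y) of (x, s) \<Rightarrow> K x s)"
      using Kx by simp
    show "integrable lborel (\<lambda>x. LINT y|lborel. norm (case (x, y) of (x, s) \<Rightarrow> K x s))"
    proof (rule Bochner_Integration.integrable_bound)
      show "integrable lborel (\<lambda>x. (indicator {a..b} x * \<psi> x) * (LINT s|lborel. \<bar>indicator {a..b} s * v s\<bar>))"
        by (intro integrable_mult_left \<psi>1)
      show "(\<lambda>x. LINT y|lborel. norm (case (x, y) of (x, s) \<Rightarrow> K x s)) \<in> borel_measurable lborel"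
        using Kmeas by measurable
      have "(LINT s|lborel. \<bar>K x s\<bar>) \<le> \<bar>indicator {a..b} x * \<psi> x\<bar> * (LINT s|lborel. \<bar>indicator {a..b} s * v s\<bar>)" for x
      proof -
        have "(LINT s|lborel. \<bar>K x s\<bar>) \<le> (LINT s|lborel. \<bar>indicator {a..b} x * \<psi> x\<bar> * \<bar>indicator {a..b} s * v s\<bar>)"
        proof (rule integral_mono)
          show "integrable lborel (\<lambda>s. \<bar>K x s\<bar>)" by (rule integrable_abs[OF Kx])
          show "integrable lborel (\<lambda>s. \<bar>indicator {a..b} x * \<psi> x\<bar> * \<bar>indicator {a..b} s * v s\<bar>)"
            by (intro integrable_mult_right integrable_abs v1)
        qed (auto simp: K_def abs_mult)
        then show ?thesis by simp
      qed
      then show "AE x in lborel. norm (LINT y|lborel. norm (case (x, y) of (x, s) \<Rightarrow> K x s))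
          \<le> norm ((indicator {a..b} x * \<psi> x) * (LINT s|lborel. \<bar>indicator {a..b} s * v s\<bar>))"
        by (simp add: abs_mult)
    qed
  qed
  then have swap: "(LINT s|lborel. LINT x|lborel. K x s) = (LINT x|lborel. LINT s|lborel. K x s)"
    by (rule lborel_pair.Fubini_integral)
  have inner1: "(LINT s|lborel. K x s) = primitive v x * \<psi> x - primitive v a * (indicator {a..b} x * \<psi> x)" for x
  proof (cases "x \<in> {a..b}")
    case True
    have "(LINT s|lborel. K x s) = \<psi> x * (LINT s:{a..x}|lborel. v s)"
      unfolding set_lebesgue_integral_def integral_mult_right_zero[symmetric]
      by (intro Bochner_Integration.integral_cong) (use True in \<open>auto simp: K_def indicator_def\<close>)
    also have "(LINT s:{a..x}|lborel. v s) = primitive v x - primitive v a"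
      using primitive_diff[OF hk(1), of a x] True hk(2) by simp
    finally show ?thesis using True by (simp add: algebra_simps)
  next
    case False
    then show ?thesis using supp by (simp add: K_def)
  qed
  have inner2: "(LINT x|lborel. K x s) = - (v s * (indicator {a..b} s * integral {a..s} \<psi>))" for s
  proof (cases "s \<in> {a..b}")
    case True
    have "(LINT x|lborel. K x s) = v s * (LINT x:{s..b}|lborel. \<psi> x)"
      unfolding set_lebesgue_integral_def integral_mult_right_zero[symmetric]
      by (intro Bochner_Integration.integral_cong) (use True in \<open>auto simp: K_def indicator_def\<close>)
    also have "(LINT x:{s..b}|lborel. \<psi> x) = integral {s..b} \<psi>"
      by (rule set_borel_integral_eq_integral(2)[OF \<psi>int])
    also have "\<dots> = - integral {a..s} \<psi>"
      using Henstock_Kurzweil_Integration.integral_combine[of a s b \<psi>] True mean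
        set_borel_integral_eq_integral(1)[OF \<psi>int] by simp
    finally show ?thesis using True by simp
  next
    case False
    then show ?thesis by (simp add: K_def)
  qed
  have m0: "(LINT x|lborel. indicator {a..b} x * \<psi> x) = 0"
    using set_borel_integral_eq_integral(2)[OF \<psi>int, of a b] mean by (simp add: set_lebesgue_integral_def)
  have "integrable lborel (\<lambda>x. primitive v x * \<psi> x)"
  proof -
    have "set_integrable lborel {a..b} (\<lambda>x. primitive v x * \<psi> x)"
      using continuous_on_primitive[OF hk(1)] cont
      by (intro borel_integrable_atLeastAtMost' continuous_on_mult) (auto intro: continuous_on_subset)
    moreover have "(\<lambda>x. indicator {a..b} x *\<^sub>R (primitive v x * \<psi> x)) = (\<lambda>x. primitive v x * \<psi> x)"
    proof
      fix x
      show "indicator {a..b} x *\<^sub>R (primitive v x * \<psi> x) = primitive v x * \<psi> x"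
        using supp[of x] by (cases "x \<in> {a..b}") simp_all
    qed
    ultimately show ?thesis by (simp add: set_integrable_def)
  qed
  then have "(LINT x|lborel. LINT s|lborel. K x s) = (LINT x|lborel. primitive v x * \<psi> x)"
    unfolding inner1 using \<psi>1 m0 by simp
  then show ?thesis using swap unfolding inner2 by simp
qed

lemma borel_representative:
  assumes "locally_integrable f"
  obtains g where "f \<in> borel_measurable lebesgue" "g \<in> borel_measurable borel" "AE x in lborel. f x = g x"
    "\<And>a b. set_integrable lborel {a..b} g"
proof -
  have loc: "set_integrable lebesgue {a..b} f" for a b
    using assms by (simp add: locally_integrable_def)
  have f: "f \<in> borel_measurable lebesgue"
  proof (rule borel_measurable_LIMSEQ_real)
    show "(\<lambda>x. indicator {- real n..real n} x *\<^sub>R f x) \<in> borel_measurable lebesgue" for n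
      using loc unfolding set_integrable_def by blast
    show "(\<lambda>n. indicator {- real n..real n} x *\<^sub>R f x) \<longlonglongrightarrow> f x" for x
    proof (rule tendsto_eventually)
      obtain N where "\<bar>x\<bar> \<le> real N" using real_arch_simple by blast
      then show "\<forall>\<^sub>F n in sequentially. indicator {- real n..real n} x *\<^sub>R f x = f x"
        by (auto simp: indicator_def intro!: eventually_sequentiallyI[of N])
    qed
  qed
  from completion_ex_borel_measurable_real[OF f] obtain g where g[measurable]: "g \<in> borel_measurable borel" and ae: "AE x in lborel. f x = g x"
    by auto
  have "set_integrable lborel {a..b} g" for a b
  proof -
    have "integrable lebesgue (\<lambda>x. indicator {a..b} x *\<^sub>R f x)"
      using loc by (simp add: set_integrable_def)
    moreover have "(\<lambda>x. indicator {a..b} x *\<^sub>R g x) \<in> borel_measurable lborel" by simp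
    moreover have "AE x in lebesgue. indicator {a..b} x *\<^sub>R f x = indicator {a..b} x *\<^sub>R g x"
      using AE_completion[OF ae] by eventually_elim simp
    ultimately have "integrable lebesgue (\<lambda>x. indicator {a..b} x *\<^sub>R g x)"
      by (rule integrable_cong_AE_imp[OF _ measurable_completion])
    then show ?thesis
      by (simp add: set_integrable_def integrable_completion)
  qed
  with f g ae show thesis by (rule that)
qed

text \<open>
  By definition of the weak derivative and \<open>primitive_integration_by_parts\<close>, the difference of \<open>u\<close> and
  a primitive of \<open>u'\<close> is orthogonal to all smooth functions of mean zero, because each of these is the
  derivative of a test function. By \<open>du_Bois_Reymond\<close> the difference is constant almost everywhere.
\<close>

lemma continuous_representative:
  assumes "distributional_derivative u u'"
  obtains U v where "continuous_on UNIV U" "v \<in> borel_measurable borel"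
    "AE x in lborel. u x = U x" "AE x in lborel. u' x = v x"
    "\<And>a b. set_integrable lborel {a..b} v"
    "\<And>x y. x \<le> y \<Longrightarrow> U y - U x = integral {x..y} v"
proof -
  have loc: "locally_integrable u" "locally_integrable u'"
    using assms by (simp_all add: distributional_derivative_def)
  from borel_representative[OF loc(1)] obtain g where mu: "u \<in> borel_measurable lebesgue"
    and [measurable]: "g \<in> borel_measurable borel"
    and aeu: "AE x in lborel. u x = g x" and intg: "\<And>a b. set_integrable lborel {a..b} g" by blast
  from borel_representative[OF loc(2)] obtain v where mu': "u' \<in> borel_measurable lebesgue"
    and [measurable]: "v \<in> borel_measurable borel"
    and aev: "AE x in lborel. u' x = v x" and intv: "\<And>a b. set_integrable lborel {a..b} v" by blast
  note hk = set_borel_integral_eq_integral(1)[OF intv]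
  have contV: "continuous_on UNIV (primitive v)"
    by (rule continuous_on_primitive[OF hk])
  then have [measurable]: "primitive v \<in> borel_measurable borel"
    by (rule borel_measurable_continuous_onI)
  have intV: "set_integrable lborel {a..b} (primitive v)" for a b
    by (rule borel_integrable_atLeastAtMost'[OF continuous_on_subset[OF contV]]) simp
  define w where "w x = g x - primitive v x" for x
  have "AE x in lborel. w x = integral {0..1} w"
  proof (rule du_Bois_Reymond)
    show "w \<in> borel_measurable borel" unfolding w_def by simp
    show "set_integrable lborel {a..b} w" for a b
      unfolding w_def by (rule set_integral_diff[OF intg intV])
    fix \<psi> and a b :: real
    assume "a \<le> b" and \<psi>: "flat_algebra \<psi>" and supp: "\<And>x. x \<notin> {a..b} \<Longrightarrow> \<psi> x = 0"
      and mean: "(LINT x|lborel. \<psi> x) = 0"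
    have c\<psi>: "continuous_on A \<psi>" for A by (rule flat_algebra_continuous_on[OF \<psi>])
    have [measurable]: "\<psi> \<in> borel_measurable borel"
      by (rule borel_measurable_continuous_onI[OF c\<psi>])
    have \<psi>int: "set_integrable lborel {c..d} \<psi>" for c d
      by (rule borel_integrable_atLeastAtMost'[OF c\<psi>])
    note \<psi>hk = set_borel_integral_eq_integral[OF \<psi>int]
    have ind: "indicator {a..b} x * \<psi> x = \<psi> x" for x
      using supp[of x] by (auto simp: indicator_def)
    have mean': "integral {a..b} \<psi> = 0"
      using mean \<psi>hk(2)[of a b] ind by (simp add: set_lebesgue_integral_def)
    (* the lower limit min a x makes the primitive vanish to the left of a without a case distinction *)
    define \<phi> where "\<phi> = (\<lambda>x. integral {min a x..x} \<psi>)"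
    have \<phi>1: "\<phi> x = indicator {a..b} x * integral {a..x} \<psi>" for x
    proof -
      consider "x < a" | "x \<in> {a..b}" | "b < x" by fastforce
      then show ?thesis
      proof cases
        case 3
        have "integral {b..x} \<psi> = integral {b..x} (\<lambda>_. 0)"
          by (rule integral_spike[of "{b}"]) (auto intro: supp)
        then have "integral {a..x} \<psi> = 0"
          using Henstock_Kurzweil_Integration.integral_combine[of a b x \<psi>] \<open>a \<le> b\<close> 3 mean' \<psi>hk(1) by simp
        with 3 \<open>a \<le> b\<close> show ?thesis by (simp add: \<phi>_def min_def)
      qed (auto simp: \<phi>_def min_def)
    qed
    have \<phi>deriv: "(\<phi> has_real_derivative \<psi> x) (at x)" for x
    proof -
      (* moving the base point below both a and x makes x an interior point *)
      define l where "l = min a x - 1"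
      have eq: "\<phi> y = integral {l..y} \<psi>" if "y > l" for y
      proof -
        have "integral {l..min a y} \<psi> = integral {l..min a y} (\<lambda>_. 0)"
          by (rule integral_spike[of "{a}"]) (auto intro: supp)
        then show ?thesis
          using Henstock_Kurzweil_Integration.integral_combine[of l "min a y" y \<psi>] that \<psi>hk(1)
          by (simp add: \<phi>_def l_def)
      qed
      have "((\<lambda>y. integral {l..y} \<psi>) has_real_derivative \<psi> x) (at x within {l..x + 1})"
        by (rule integral_has_real_derivative[OF c\<psi>]) (auto simp: l_def)
      then have "((\<lambda>y. integral {l..y} \<psi>) has_real_derivative \<psi> x) (at x)"
        by (subst (asm) at_within_interior) (auto simp: l_def)
      then show ?thesis
        by (rule has_field_derivative_transform_within_open[of _ _ _ "{l<..}"])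
          (auto simp: eq l_def)
    qed
    have "test_function \<phi>"
      by (rule test_function_antiderivative[OF \<psi> \<phi>deriv, of a b]) (simp add: \<phi>1)
    moreover have "deriv \<phi> = \<psi>" using \<phi>deriv by (auto intro: DERIV_imp_deriv)
    ultimately have "(LINT t|lebesgue. u t * \<psi> t) = - (LINT t|lebesgue. u' t * \<phi> t)"
      using assms by (auto simp: distributional_derivative_def)
    moreover have [measurable]: "\<phi> \<in> borel_measurable borel"
      by (rule borel_measurable_continuous_onI)
        (meson \<phi>deriv DERIV_isCont continuous_at_imp_continuous_on)
    have lebesgue_borel: "(LINT t|lebesgue. f t * h t) = (LINT t|lborel. g t * h t)"
      if "AE x in lborel. f x = g x" and [measurable]: "g \<in> borel_measurable borel" "h \<in> borel_measurable borel"
        and "f \<in> borel_measurable lebesgue" for f g h :: "real \<Rightarrow> real"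
    proof -
      have [measurable]: "g \<in> borel_measurable lebesgue" "h \<in> borel_measurable lebesgue"
        by (auto intro: measurable_completion)
      have "(LINT t|lebesgue. f t * h t) = (LINT t|lebesgue. g t * h t)"
        by (rule integral_cong_AE) (use that AE_completion[OF that(1)] in auto)
      also have "\<dots> = (LINT t|lborel. g t * h t)" by (rule integral_completion) simp
      finally show ?thesis .
    qed
    ultimately have eq: "(LINT t|lborel. g t * \<psi> t) = - (LINT t|lborel. v t * \<phi> t)"
      using lebesgue_borel[OF aeu _ _ mu, of \<psi>] lebesgue_borel[OF aev _ _ mu', of \<phi>] by simp
    have "(LINT t|lborel. primitive v t * \<psi> t) = - (LINT t|lborel. v t * \<phi> t)"
      unfolding \<phi>1 by (rule primitive_integration_by_parts[OF _ intv \<open>a \<le> b\<close> c\<psi> supp mean']) auto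
    moreover have i: "integrable lborel (\<lambda>t. f t * \<psi> t)"
      if int: "\<And>a b. set_integrable lborel {a..b} f" and [measurable]: "f \<in> borel_measurable borel" for f :: "real \<Rightarrow> real"
    proof -
      have "bounded (\<psi> ` {a..b})" by (rule compact_imp_bounded[OF compact_continuous_image[OF c\<psi>]]) simp
      then obtain B where B: "\<forall>x\<in>{a..b}. \<bar>\<psi> x\<bar> \<le> B" by (auto simp: bounded_iff)
      have "integrable lborel (\<lambda>t. B * (indicator {a..b} t * f t))"
        using int[of a b] by (simp add: set_integrable_def)
      then show ?thesis
      proof (rule Bochner_Integration.integrable_bound)
        have "\<bar>f t * \<psi> t\<bar> \<le> \<bar>B * (indicator {a..b} t * f t)\<bar>" for t
        proof (cases "t \<in> {a..b}")
          case True
          have "\<bar>f t\<bar> * \<bar>\<psi> t\<bar> \<le> \<bar>f t\<bar> * \<bar>B\<bar>"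
            using bspec[OF B True] by (intro mult_left_mono) auto
          with True show ?thesis by (simp add: abs_mult mult.commute)
        qed (use supp in simp)
        then show "AE t in lborel. norm (f t * \<psi> t) \<le> norm (B * (indicator {a..b} t * f t))" by simp
      qed simp
    qed
    ultimately show "(LINT x|lborel. w x * \<psi> x) = 0"
      using eq i[OF intg] i[OF intV] by (simp add: w_def left_diff_distrib)
  qed
  then have "AE x in lborel. g x = primitive v x + integral {0..1} w"
    by eventually_elim (simp add: w_def)
  with aeu have "AE x in lborel. u x = primitive v x + integral {0..1} w"
    by eventually_elim simp
  then show thesis
  proof (intro that[of "\<lambda>x. primitive v x + integral {0..1} w" v])
    show "continuous_on UNIV (\<lambda>x. primitive v x + integral {0..1} w)"
      by (intro continuous_intros contV)
  qed (use aev intv primitive_diff[OF hk] in auto)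
qed

section \<open>Linear growth under the Sawyer condition\<close>

lemma nn_set_integral_eq_ennreal:
  fixes f :: "'a \<Rightarrow> real"
  assumes "set_integrable M A f" and "\<And>x. 0 \<le> f x"
  shows "(\<integral>\<^sup>+x\<in>A. ennreal (f x) \<partial>M) = ennreal (LINT x:A|M. f x)"
proof -
  have "(\<integral>\<^sup>+x\<in>A. ennreal (f x) \<partial>M) = (\<integral>\<^sup>+x. ennreal (indicator A x *\<^sub>R f x) \<partial>M)"
    by (intro nn_integral_cong) (auto simp: indicator_def)
  also have "\<dots> = ennreal (LINT x:A|M. f x)"
    unfolding set_lebesgue_integral_def
    using assms by (intro nn_integral_eq_integral) (auto simp: set_integrable_def)
  finally show ?thesis .
qed

lemma weight_integral_pos:
  assumes "weight \<omega>"
  shows "0 < (LINT \<tau>:{t..t + 1}|lebesgue. \<omega> \<tau>)"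
proof -
  have int: "integrable lebesgue (\<lambda>\<tau>. indicator {t..t + 1} \<tau> *\<^sub>R \<omega> \<tau>)" and pos: "\<And>x. 0 < \<omega> x"
    using assms by (auto simp: weight_def locally_integrable_def set_integrable_def)
  have "0 \<le> (LINT \<tau>:{t..t + 1}|lebesgue. \<omega> \<tau>)"
    unfolding set_lebesgue_integral_def using pos by (intro Bochner_Integration.integral_nonneg) (auto simp: less_imp_le)
  moreover have "(LINT \<tau>:{t..t + 1}|lebesgue. \<omega> \<tau>) \<noteq> 0"
  proof
    assume "(LINT \<tau>:{t..t + 1}|lebesgue. \<omega> \<tau>) = 0"
    then have "AE \<tau> in lebesgue. indicator {t..t + 1} \<tau> *\<^sub>R \<omega> \<tau> = 0"
      unfolding set_lebesgue_integral_def
      by (subst (asm) integral_nonneg_eq_0_iff_AE[OF int]) (auto intro!: AE_I2 simp: pos less_imp_le)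
    then have "AE \<tau> in lebesgue. \<tau> \<notin> {t..t + 1}"
      by eventually_elim (use pos in \<open>auto simp: indicator_def less_le\<close>)
    then have "{t..t + 1} \<in> null_sets lebesgue"
      by (subst AE_iff_null_sets) auto
    then show False by (auto simp: null_sets_def)
  qed
  ultimately show ?thesis by linarith
qed

text \<open>
  This is Young's inequality for \<open>x * w powr (1 / p)\<close> and \<open>w powr (- 1 / p)\<close>, scaled by \<open>h\<close> and without
  sharp constants: the first or the second summand dominates \<open>x\<close> according to whether
  \<open>x powr (p - 1) * (h * w)\<close> is at least \<open>1\<close> or not. In the application \<open>h\<close> is the length of the interval
  of integration, which makes both summands contribute at most a multiple of \<open>h\<close>.
\<close>

lemma Young_weighted:
  fixes x w h p :: real
  assumes "1 < p" "0 \<le> x" "0 < w" "0 < h"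
  shows "x \<le> h * (x powr p * w) + (h * w) powr (- (1 / (p - 1)))"
proof (cases "1 \<le> x powr (p - 1) * (h * w)")
  case True
  have "x * 1 \<le> x * (x powr (p - 1) * (h * w))"
    using True assms by (intro mult_left_mono)
  also have "x * x powr (p - 1) = x powr p"
    using assms by (cases "x = 0") (auto simp: powr_mult_base)
  then have "x * (x powr (p - 1) * (h * w)) = h * (x powr p * w)"
    by (metis (no_types, lifting) mult.assoc mult.commute)
  finally have "x \<le> h * (x powr p * w)" by simp
  moreover have "0 \<le> (h * w) powr (- (1 / (p - 1)))" by simp
  ultimately show ?thesis by linarith
next
  case False
  then have "x powr (p - 1) \<le> (h * w) powr (- 1)"
    using assms by (simp add: powr_minus field_simps)
  then have "(x powr (p - 1)) powr (1 / (p - 1)) \<le> ((h * w) powr (- 1)) powr (1 / (p - 1))"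
    using assms by (intro powr_mono2) auto
  moreover have "(x powr (p - 1)) powr (1 / (p - 1)) = x"
    using assms by (simp add: powr_powr)
  moreover have "((h * w) powr (- 1)) powr (1 / (p - 1)) = (h * w) powr (- (1 / (p - 1)))"
    unfolding powr_powr by simp
  ultimately have "x \<le> (h * w) powr (- (1 / (p - 1)))" by simp
  moreover have "0 \<le> h * (x powr p * w)" using assms by simp
  ultimately show ?thesis by linarith
qed

text \<open>
  The Sawyer condition bounds the average of the dual weight over \<open>[t - h, t]\<close> by a negative power of
  the average of the weight over \<open>[t, t + h]\<close>, and the integral of the weight there is at least the fixed positive number \<open>W\<close> obtained for \<open>h = 1\<close>. This controls the
  integral of \<open>\<bar>u\<bar>\<close> by the weighted norm of \<open>u\<close>, through \<open>Young_weighted\<close> if \<open>p > 1\<close>. If \<open>p = 1\<close>, then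
  almost every \<open>s\<close> in \<open>[t - h, t]\<close> satisfies \<open>\<omega> s \<ge> W / (2 * C * h)\<close>, because the interval
  \<open>[s, s + 2 * h]\<close> contains \<open>[t, t + 1]\<close>.
\<close>

lemma weighted_Lp_linear_growth:
  assumes "1 \<le> p" and \<omega>: "\<omega> \<in> sawyer_minus p" and u: "u \<in> weighted_Lp p \<omega>"
  obtains K where "0 \<le> K"
    "\<And>h. 1 \<le> h \<Longrightarrow> (\<integral>\<^sup>+\<tau>\<in>{t - h..t}. ennreal \<bar>u \<tau>\<bar> \<partial>lebesgue) \<le> ennreal (K * h)"
proof -
  have w: "weight \<omega>" using \<omega> by (auto simp: sawyer_minus_def)
  then have pos: "\<And>x. 0 < \<omega> x" and int: "\<And>a b. set_integrable lebesgue {a..b} \<omega>"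
    by (auto simp: weight_def locally_integrable_def)
  have nn: "\<And>x. 0 \<le> \<omega> x" using pos by (simp add: less_imp_le)
  have mu[measurable]: "u \<in> borel_measurable lebesgue"
    and I: "integrable lebesgue (\<lambda>t. \<bar>u t\<bar> powr p * \<omega> t)"
    using u by (auto simp: weighted_Lp_def)
  define J where "J = (LINT t|lebesgue. \<bar>u t\<bar> powr p * \<omega> t)"
  have J: "(\<integral>\<^sup>+t. ennreal (\<bar>u t\<bar> powr p * \<omega> t) \<partial>lebesgue) = ennreal J" "0 \<le> J"
    unfolding J_def using I nn by (auto intro!: nn_integral_eq_integral Bochner_Integration.integral_nonneg)
  define W where "W = (LINT \<tau>:{t..t + 1}|lebesgue. \<omega> \<tau>)"
  have W: "0 < W" unfolding W_def by (rule weight_integral_pos[OF w])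
  have W': "(\<integral>\<^sup>+\<tau>\<in>{t..t + 1}. ennreal (\<omega> \<tau>) \<partial>lebesgue) = ennreal W"
    unfolding W_def by (rule nn_set_integral_eq_ennreal[OF int nn])
  show thesis
  proof (cases "p = 1")
    case True
    then obtain C where C: "0 < C" and ae: "AE s in lebesgue. maximal_plus \<omega> s \<le> ennreal (C * \<omega> s)"
      using \<omega> by (auto simp: sawyer_minus_def)
    show thesis
    proof (rule that[of "2 * C * J / W"])
      show "0 \<le> 2 * C * J / W" using C J(2) W by simp
      fix h :: real assume h: "1 \<le> h"
      have "(\<integral>\<^sup>+\<tau>\<in>{t - h..t}. ennreal \<bar>u \<tau>\<bar> \<partial>lebesgue)
          \<le> (\<integral>\<^sup>+\<tau>. ennreal (2 * h * C / W) * ennreal (\<bar>u \<tau>\<bar> powr p * \<omega> \<tau>) \<partial>lebesgue)"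
        using ae
      proof (intro nn_integral_mono_AE, eventually_elim)
        case (elim s)
        show ?case
        proof (cases "s \<in> {t - h..t}")
          case s: True
          (* the factor 2 ensures s + 2 * h >= t + 1, as s >= t - h and h >= 1 *)
          have "ennreal (1 / (2 * h)) * ennreal W \<le> ennreal (1 / (2 * h)) * (\<integral>\<^sup>+\<tau>\<in>{s..s + 2 * h}. ennreal \<bar>\<omega> \<tau>\<bar> \<partial>lebesgue)"
            unfolding W'[symmetric]
            by (intro mult_left_mono nn_integral_mono) (use s h nn in \<open>auto simp: indicator_def\<close>)
          also have "\<dots> \<le> maximal_plus \<omega> s"
            unfolding maximal_plus_def by (rule SUP_upper) (use h in auto)
          also have "\<dots> \<le> ennreal (C * \<omega> s)" by (rule elim)
          finally have "ennreal (W / (2 * h)) \<le> ennreal (C * \<omega> s)"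
            using h W by (simp add: ennreal_mult'[symmetric])
          then have "W / (2 * h) \<le> C * \<omega> s"
            using C nn by (subst (asm) ennreal_le_iff) auto
          then have "1 \<le> 2 * h * C / W * \<omega> s" using W h by (simp add: field_simps)
          then have "\<bar>u s\<bar> * 1 \<le> \<bar>u s\<bar> * (2 * h * C / W * \<omega> s)"
            by (intro mult_left_mono) auto
          then have "\<bar>u s\<bar> \<le> (2 * h * C / W) * (\<bar>u s\<bar> powr p * \<omega> s)"
            using True by (simp add: mult_ac)
          then show ?thesis
            using s W h C nn by (simp add: ennreal_mult'[symmetric] ennreal_leI)
        qed simp
      qed
      also have "\<dots> = ennreal (2 * h * C / W) * ennreal J"
        using I by (subst nn_integral_cmult) (auto simp: J borel_measurable_integrable)
      also have "\<dots> = ennreal (2 * C * J / W * h)"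
        using W h C J(2) by (simp add: ennreal_mult'[symmetric] mult_ac)
      finally show "(\<integral>\<^sup>+\<tau>\<in>{t - h..t}. ennreal \<bar>u \<tau>\<bar> \<partial>lebesgue) \<le> ennreal (2 * C * J / W * h)" .
    qed
  next
    case False
    with \<open>1 \<le> p\<close> have p: "1 < p" by simp
    define q where "q = conjugate_exponent p"
    define s where "s = 1 / (p - 1)"
    have s: "0 < s" "1 - q = - s" "q = 1 + s" "0 < q" "q / p = s"
      using p by (auto simp: q_def s_def conjugate_exponent_def field_simps)
    from \<omega> False obtain C where loc: "locally_integrable (\<lambda>\<tau>. \<omega> \<tau> powr (1 - q))" and C: "0 < C"
      and bd: "\<And>a h. 0 < h \<Longrightarrow> (1 / h * (LINT \<tau>:{a..a + h}|lebesgue. \<omega> \<tau>)) powr (1 / p) *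
              (1 / h * (LINT \<tau>:{a - h..a}|lebesgue. \<omega> \<tau> powr (1 - q))) powr (1 / q) \<le> C"
      by (auto simp: sawyer_minus_def q_def Let_def)
    show thesis
    proof (rule that[of "J + C powr q * W powr (- s)"])
      show "0 \<le> J + C powr q * W powr (- s)" using J(2) by simp
      fix h :: real assume h: "1 \<le> h"
      define A where "A = (LINT \<tau>:{t - h..t}|lebesgue. \<omega> \<tau> powr (1 - q))"
      define V where "V = (LINT \<tau>:{t..t + h}|lebesgue. \<omega> \<tau>)"
      have A0: "0 \<le> A" unfolding A_def set_lebesgue_integral_def by (intro Bochner_Integration.integral_nonneg) auto
      have "W \<le> V"
        unfolding W_def V_def set_lebesgue_integral_def
        using int[of t "t + 1"] int[of t "t + h"] h nn
        by (intro integral_mono) (auto simp: set_integrable_def indicator_def)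
      have iA: "set_integrable lebesgue {t - h..t} (\<lambda>\<tau>. \<omega> \<tau> powr (1 - q))"
        using loc by (simp add: locally_integrable_def)
      (* solve the Sawyer condition for A, using 1 - q = - s and q / p = s *)
      have "(W / h) powr (1 / p) * (A / h) powr (1 / q) \<le> (V / h) powr (1 / p) * (A / h) powr (1 / q)"
        using h W p \<open>W \<le> V\<close> by (intro mult_right_mono powr_mono2 divide_right_mono) auto
      also have "\<dots> \<le> C" using bd[of h t] h by (simp add: A_def V_def)
      finally have "(A / h) powr (1 / q) \<le> C * (W / h) powr (- (1 / p))"
        using W h by (simp add: powr_minus field_simps)
      then have "((A / h) powr (1 / q)) powr q \<le> (C * (W / h) powr (- (1 / p))) powr q"
        using s by (intro powr_mono2) auto
      then have "A / h \<le> C powr q * (W / h) powr (- s)"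
        using s A0 C h W p by (simp add: powr_powr powr_mult)
      also have "\<dots> = C powr q * W powr (- s) * h powr s"
        using W h by (simp add: powr_divide powr_minus field_simps)
      finally have "h powr (- s) * A \<le> C powr q * W powr (- s) * h"
        using h by (simp add: powr_minus field_simps)
      have "(\<integral>\<^sup>+\<tau>\<in>{t - h..t}. ennreal \<bar>u \<tau>\<bar> \<partial>lebesgue)
          \<le> (\<integral>\<^sup>+\<tau>. (ennreal h * ennreal (\<bar>u \<tau>\<bar> powr p * \<omega> \<tau>) +
              ennreal (h powr (- s)) * (ennreal (\<omega> \<tau> powr (1 - q)) * indicator {t - h..t} \<tau>)) \<partial>lebesgue)"
      proof (rule nn_integral_mono)
        fix \<tau>
        have "\<bar>u \<tau>\<bar> \<le> h * (\<bar>u \<tau>\<bar> powr p * \<omega> \<tau>) + h powr (- s) * \<omega> \<tau> powr (1 - q)"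
          using Young_weighted[OF p, of "\<bar>u \<tau>\<bar>" "\<omega> \<tau>" h] pos[of \<tau>] h
          by (simp add: powr_mult s(2) flip: s_def)
        then have "ennreal \<bar>u \<tau>\<bar> \<le> ennreal h * ennreal (\<bar>u \<tau>\<bar> powr p * \<omega> \<tau>) + ennreal (h powr (- s)) * ennreal (\<omega> \<tau> powr (1 - q))"
          using h nn by (simp add: ennreal_leI flip: ennreal_mult ennreal_plus)
        then show "ennreal \<bar>u \<tau>\<bar> * indicator {t - h..t} \<tau> \<le> ennreal h * ennreal (\<bar>u \<tau>\<bar> powr p * \<omega> \<tau>) +
              ennreal (h powr (- s)) * (ennreal (\<omega> \<tau> powr (1 - q)) * indicator {t - h..t} \<tau>)"
          by (auto simp: indicator_def)
      qed
      also have "\<dots> = ennreal h * (\<integral>\<^sup>+\<tau>. ennreal (\<bar>u \<tau>\<bar> powr p * \<omega> \<tau>) \<partial>lebesgue) +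
          ennreal (h powr (- s)) * (\<integral>\<^sup>+\<tau>\<in>{t - h..t}. ennreal (\<omega> \<tau> powr (1 - q)) \<partial>lebesgue)"
      proof -
        have [measurable]: "(\<lambda>\<tau>. \<bar>u \<tau>\<bar> powr p * \<omega> \<tau>) \<in> borel_measurable lebesgue"
          using I by (rule borel_measurable_integrable)
        have "(\<lambda>\<tau>. ennreal (indicator {t - h..t} \<tau> *\<^sub>R \<omega> \<tau> powr (1 - q))) \<in> borel_measurable lebesgue"
          using iA unfolding set_integrable_def by measurable
        also have "(\<lambda>\<tau>. ennreal (indicator {t - h..t} \<tau> *\<^sub>R \<omega> \<tau> powr (1 - q)))
            = (\<lambda>\<tau>. ennreal (\<omega> \<tau> powr (1 - q)) * indicator {t - h..t} \<tau>)"
          by (auto simp: indicator_def)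
        finally have [measurable]: "(\<lambda>\<tau>. ennreal (\<omega> \<tau> powr (1 - q)) * indicator {t - h..t} \<tau>) \<in> borel_measurable lebesgue" .
        show ?thesis by (simp add: nn_integral_add nn_integral_cmult)
      qed
      also have "(\<integral>\<^sup>+\<tau>\<in>{t - h..t}. ennreal (\<omega> \<tau> powr (1 - q)) \<partial>lebesgue) = ennreal A"
        unfolding A_def by (rule nn_set_integral_eq_ennreal[OF iA]) simp
      also have "ennreal h * (\<integral>\<^sup>+\<tau>. ennreal (\<bar>u \<tau>\<bar> powr p * \<omega> \<tau>) \<partial>lebesgue) + ennreal (h powr (- s)) * ennreal A
          = ennreal (h * J + h powr (- s) * A)"
        using h J A0 by (simp add: flip: ennreal_mult ennreal_plus)
      also have "\<dots> \<le> ennreal ((J + C powr q * W powr (- s)) * h)"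
        using \<open>h powr (- s) * A \<le> _\<close> by (intro ennreal_leI) (simp add: algebra_simps)
      finally show "(\<integral>\<^sup>+\<tau>\<in>{t - h..t}. ennreal \<bar>u \<tau>\<bar> \<partial>lebesgue) \<le> ennreal ((J + C powr q * W powr (- s)) * h)" .
    qed
  qed
qed

section \<open>Convergence near zero and decay of the tail\<close>

lemma nn_integral_powr_0_1:
  fixes a :: real
  assumes "a > - 1"
  shows "(\<integral>\<^sup>+\<tau>\<in>{0<..1}. ennreal (\<tau> powr a) \<partial>lborel) = ennreal (1 / (a + 1))"
proof -
  have "(\<integral>\<^sup>+\<tau>\<in>{0<..1}. ennreal (\<tau> powr a) \<partial>lborel) = integral\<^sup>N lborel (\<lambda>x::real. indicator {0..1} x * x powr a)"
    by (intro nn_integral_cong) (auto simp: indicator_def)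
  also have "\<dots> = ennreal (1 powr (a + 1) / (a + 1))"
    by (rule nn_integral_has_integral_lebesgue[OF _ has_integral_powr_from_0]) (use assms in auto)
  finally show ?thesis by simp
qed

lemma nn_integral_powr_atLeast:
  fixes a e :: real
  assumes "e < - 1" "a > 0"
  shows "(\<integral>\<^sup>+\<tau>\<in>{a..}. ennreal (\<tau> powr e) \<partial>lborel) = ennreal (- (a powr (e + 1)) / (e + 1))"
proof -
  have "(\<integral>\<^sup>+\<tau>\<in>{a..}. ennreal (\<tau> powr e) \<partial>lborel) = integral\<^sup>N lborel (\<lambda>x::real. indicator {a..} x * x powr e)"
    by (intro nn_integral_cong) (auto simp: indicator_def)
  also have "\<dots> = ennreal (- (a powr (e + 1)) / (e + 1))"
    by (rule nn_integral_has_integral_lebesgue[OF _ has_integral_powr_to_inf]) (use assms in auto)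
  finally show ?thesis .
qed

lemma nn_integral_reflect:
  fixes f :: "real \<Rightarrow> ennreal"
  assumes [measurable]: "f \<in> borel_measurable borel"
  shows "(\<integral>\<^sup>+\<tau>\<in>{0..h}. f (t - \<tau>) \<partial>lborel) = (\<integral>\<^sup>+s\<in>{t - h..t}. f s \<partial>lborel)"
proof -
  have "(\<integral>\<^sup>+s\<in>{t - h..t}. f s \<partial>lborel) = (\<integral>\<^sup>+\<tau>. f (t + (-1) * \<tau>) * indicator {t - h..t} (t + (-1) * \<tau>) \<partial>lborel)"
    by (subst nn_integral_real_affine[where c = "-1" and t = t]) auto
  also have "\<dots> = (\<integral>\<^sup>+\<tau>\<in>{0..h}. f (t - \<tau>) \<partial>lborel)"
    by (intro nn_integral_cong) (auto simp: indicator_def)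
  finally show ?thesis by simp
qed

text \<open>
  Since \<open>\<tau> powr (- 1 - \<alpha>)\<close> is the integral of \<open>(1 + \<alpha>) * s powr (- 2 - \<alpha>)\<close> over \<open>s \<ge> \<tau>\<close>, Tonelli's
  theorem reduces the claim to the growth bound on each \<open>[t - s, t]\<close>.
\<close>

lemma power_tail_bound:
  fixes f :: "real \<Rightarrow> real" and \<alpha> :: real
  assumes [measurable]: "f \<in> borel_measurable borel" and "0 < \<alpha>" "0 \<le> K"
    and growth: "\<And>h. 1 \<le> h \<Longrightarrow> (\<integral>\<^sup>+s\<in>{t - h..t}. ennreal \<bar>f s\<bar> \<partial>lborel) \<le> ennreal (K * h)"
  shows "(\<integral>\<^sup>+\<tau>\<in>{1<..}. ennreal (\<bar>f (t - \<tau>)\<bar> / \<tau> powr (1 + \<alpha>)) \<partial>lborel) \<le> ennreal (K * (1 + \<alpha>) / \<alpha>)"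
proof -
  define G where "G \<tau> s = ennreal \<bar>f (t - \<tau>)\<bar> * ennreal ((1 + \<alpha>) * s powr (- 2 - \<alpha>)) * of_bool (1 < \<tau> \<and> \<tau> \<le> s)" for \<tau> s
  have G: "case_prod G \<in> borel_measurable (lborel \<Otimes>\<^sub>M lborel)"
    unfolding G_def by measurable
  have "(\<integral>\<^sup>+\<tau>\<in>{1<..}. ennreal (\<bar>f (t - \<tau>)\<bar> / \<tau> powr (1 + \<alpha>)) \<partial>lborel) = (\<integral>\<^sup>+\<tau>. (\<integral>\<^sup>+s. G \<tau> s \<partial>lborel) \<partial>lborel)"
  proof (rule nn_integral_cong)
    fix \<tau> :: real
    show "ennreal (\<bar>f (t - \<tau>)\<bar> / \<tau> powr (1 + \<alpha>)) * indicator {1<..} \<tau> = (\<integral>\<^sup>+s. G \<tau> s \<partial>lborel)"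
    proof (cases "1 < \<tau>")
      case True
      have "(\<integral>\<^sup>+s. G \<tau> s \<partial>lborel) = (\<integral>\<^sup>+s. ennreal (\<bar>f (t - \<tau>)\<bar> * (1 + \<alpha>)) * (ennreal (s powr (- 2 - \<alpha>)) * indicator {\<tau>..} s) \<partial>lborel)"
        using True \<open>0 < \<alpha>\<close> by (intro nn_integral_cong) (auto simp: G_def indicator_def ennreal_mult' mult_ac)
      also have "\<dots> = ennreal (\<bar>f (t - \<tau>)\<bar> * (1 + \<alpha>)) * ennreal (- (\<tau> powr (- 2 - \<alpha> + 1)) / (- 2 - \<alpha> + 1))"
        using True \<open>0 < \<alpha>\<close> by (subst nn_integral_cmult) (auto simp: nn_integral_powr_atLeast)
      also have "- (\<tau> powr (- 2 - \<alpha> + 1)) / (- 2 - \<alpha> + 1) = \<tau> powr (- (1 + \<alpha>)) / (1 + \<alpha>)"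
        using \<open>0 < \<alpha>\<close> by (simp add: divide_simps) (simp add: algebra_simps)
      also have "ennreal (\<bar>f (t - \<tau>)\<bar> * (1 + \<alpha>)) * ennreal (\<tau> powr (- (1 + \<alpha>)) / (1 + \<alpha>)) = ennreal (\<bar>f (t - \<tau>)\<bar> / \<tau> powr (1 + \<alpha>))"
        using \<open>0 < \<alpha>\<close> unfolding powr_minus by (simp add: divide_inverse flip: ennreal_mult')
      finally show ?thesis using True by simp
    qed (simp add: G_def)
  qed
  also have "\<dots> = (\<integral>\<^sup>+s. (\<integral>\<^sup>+\<tau>. G \<tau> s \<partial>lborel) \<partial>lborel)"
    by (rule lborel_pair.Fubini'[OF G, symmetric])
  also have "\<dots> \<le> (\<integral>\<^sup>+s. ennreal (K * (1 + \<alpha>)) * (ennreal (s powr (- 1 - \<alpha>)) * indicator {1..} s) \<partial>lborel)"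
  proof (rule nn_integral_mono)
    fix s :: real
    show "(\<integral>\<^sup>+\<tau>. G \<tau> s \<partial>lborel) \<le> ennreal (K * (1 + \<alpha>)) * (ennreal (s powr (- 1 - \<alpha>)) * indicator {1..} s)"
    proof (cases "1 \<le> s")
      case True
      have "(\<integral>\<^sup>+\<tau>. G \<tau> s \<partial>lborel) \<le> (\<integral>\<^sup>+\<tau>. ennreal ((1 + \<alpha>) * s powr (- 2 - \<alpha>)) * (ennreal \<bar>f (t - \<tau>)\<bar> * indicator {0..s} \<tau>) \<partial>lborel)"
        by (intro nn_integral_mono) (auto simp: G_def indicator_def mult_ac)
      also have "\<dots> = ennreal ((1 + \<alpha>) * s powr (- 2 - \<alpha>)) * (\<integral>\<^sup>+\<tau>\<in>{t - s..t}. ennreal \<bar>f \<tau>\<bar> \<partial>lborel)"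
        by (subst nn_integral_cmult) (auto simp: nn_integral_reflect[of "\<lambda>x. ennreal \<bar>f x\<bar>"])
      also have "\<dots> \<le> ennreal ((1 + \<alpha>) * s powr (- 2 - \<alpha>)) * ennreal (K * s)"
        by (intro mult_left_mono growth True) simp
      also have "\<dots> = ennreal (K * (1 + \<alpha>) * (s powr (- 2 - \<alpha>) * s powr 1))"
        using True \<open>0 < \<alpha>\<close> \<open>0 \<le> K\<close> by (simp add: mult_ac flip: ennreal_mult')
      also have "s powr (- 2 - \<alpha>) * s powr 1 = s powr (- 1 - \<alpha>)"
        unfolding powr_add[symmetric] by simp
      finally show ?thesis
        using True \<open>0 < \<alpha>\<close> \<open>0 \<le> K\<close> by (simp add: ennreal_mult')
    next
      case False
      then have "G \<tau> s = 0" for \<tau> by (auto simp: G_def)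
      then show ?thesis by simp
    qed
  qed
  also have "\<dots> = ennreal (K * (1 + \<alpha>)) * ennreal (- (1 powr (- 1 - \<alpha> + 1)) / (- 1 - \<alpha> + 1))"
    using \<open>0 < \<alpha>\<close> by (subst nn_integral_cmult) (auto simp: nn_integral_powr_atLeast)
  also have "\<dots> = ennreal (K * (1 + \<alpha>) / \<alpha>)"
    using \<open>0 < \<alpha>\<close> \<open>0 \<le> K\<close> by (simp flip: ennreal_mult')
  finally show ?thesis .
qed

lemma abs_increment_le:
  fixes U v :: "real \<Rightarrow> real"
  assumes int: "set_integrable lborel {x..y} v" and eq: "U y - U x = integral {x..y} v"
  shows "ennreal \<bar>U x - U y\<bar> \<le> (\<integral>\<^sup>+s\<in>{x..y}. ennreal \<bar>v s\<bar> \<partial>lborel)"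
proof -
  have "\<bar>U x - U y\<bar> = norm (LINT s|lborel. indicator {x..y} s *\<^sub>R v s)"
    using eq set_borel_integral_eq_integral(2)[OF int] by (simp add: set_lebesgue_integral_def)
  also have "ennreal \<dots> \<le> (\<integral>\<^sup>+s. norm (indicator {x..y} s *\<^sub>R v s) \<partial>lborel)"
    using int by (intro integral_norm_bound_ennreal) (simp add: set_integrable_def)
  also have "\<dots> = (\<integral>\<^sup>+s\<in>{x..y}. ennreal \<bar>v s\<bar> \<partial>lborel)"
    by (intro nn_integral_cong) (auto simp: indicator_def)
  finally show ?thesis .
qed

text \<open>
  Each \<open>s\<close> lies in \<open>[t - \<tau>, t]\<close> only for \<open>t\<close> in an interval of length \<open>\<tau>\<close>, so integrating
  \<open>abs_increment_le\<close> over \<open>t\<close> gains the factor \<open>\<tau>\<close>.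
\<close>

lemma local_increment_bound:
  fixes U v :: "real \<Rightarrow> real"
  assumes [measurable]: "v \<in> borel_measurable borel"
    and int: "\<And>a b. set_integrable lborel {a..b} v"
    and eq: "\<And>x y. x \<le> y \<Longrightarrow> U y - U x = integral {x..y} v"
    and \<tau>: "0 < \<tau>" "\<tau> \<le> 1"
  shows "(\<integral>\<^sup>+t\<in>{- R..R}. ennreal \<bar>U (t - \<tau>) - U t\<bar> \<partial>lborel)
    \<le> ennreal \<tau> * (\<integral>\<^sup>+s\<in>{- R - 1..R}. ennreal \<bar>v s\<bar> \<partial>lborel)"
proof -
  define G where "G t s = ennreal \<bar>v s\<bar> * of_bool (- R \<le> t \<and> t \<le> R \<and> t - \<tau> \<le> s \<and> s \<le> t)" for t s
  have G: "case_prod G \<in> borel_measurable (lborel \<Otimes>\<^sub>M lborel)"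
    unfolding G_def by measurable
  have "(\<integral>\<^sup>+t\<in>{- R..R}. ennreal \<bar>U (t - \<tau>) - U t\<bar> \<partial>lborel) \<le> (\<integral>\<^sup>+t. (\<integral>\<^sup>+s. G t s \<partial>lborel) \<partial>lborel)"
  proof (rule nn_integral_mono)
    fix t
    have "(\<integral>\<^sup>+s. G t s \<partial>lborel) = (\<integral>\<^sup>+s\<in>{t - \<tau>..t}. ennreal \<bar>v s\<bar> \<partial>lborel)" if "t \<in> {- R..R}"
      using that by (intro nn_integral_cong) (auto simp: G_def indicator_def)
    then show "ennreal \<bar>U (t - \<tau>) - U t\<bar> * indicator {- R..R} t \<le> (\<integral>\<^sup>+s. G t s \<partial>lborel)"
      using abs_increment_le[where x = "t - \<tau>" and y = t, OF int eq] \<tau> by (auto simp: indicator_def)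
  qed
  also have "\<dots> = (\<integral>\<^sup>+s. (\<integral>\<^sup>+t. G t s \<partial>lborel) \<partial>lborel)"
    by (rule lborel_pair.Fubini'[OF G, symmetric])
  also have "\<dots> \<le> (\<integral>\<^sup>+s. ennreal \<tau> * (ennreal \<bar>v s\<bar> * indicator {- R - 1..R} s) \<partial>lborel)"
  proof (rule nn_integral_mono)
    fix s
    have "(\<integral>\<^sup>+t. G t s \<partial>lborel) \<le> (\<integral>\<^sup>+t. (ennreal \<bar>v s\<bar> * indicator {- R - 1..R} s) * indicator {s..s + \<tau>} t \<partial>lborel)"
      by (intro nn_integral_mono) (use \<tau> in \<open>auto simp: G_def indicator_def\<close>)
    also have "\<dots> = ennreal \<tau> * (ennreal \<bar>v s\<bar> * indicator {- R - 1..R} s)"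
      using \<tau> by (subst nn_integral_cmult_indicator) (auto simp: mult.commute)
    finally show "(\<integral>\<^sup>+t. G t s \<partial>lborel) \<le> ennreal \<tau> * (ennreal \<bar>v s\<bar> * indicator {- R - 1..R} s)" .
  qed
  also have "\<dots> = ennreal \<tau> * (\<integral>\<^sup>+s\<in>{- R - 1..R}. ennreal \<bar>v s\<bar> \<partial>lborel)"
    by (rule nn_integral_cmult) simp
  finally show ?thesis .
qed

text \<open>
  By \<open>local_increment_bound\<close> and Tonelli's theorem, the integral of the left-hand side over a bounded
  interval of \<open>t\<close> is at most a multiple of the integral of \<open>\<tau> powr (- \<alpha>)\<close> over \<open>(0, 1]\<close>, which is finite. One
  null set serves all exponents, as on \<open>(0, 1]\<close> the integrand increases with \<open>\<alpha>\<close> and a sequence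
  of exponents tending to \<open>1\<close> suffices.
\<close>

lemma AE_near_zero_finite:
  fixes U v :: "real \<Rightarrow> real"
  assumes cont: "continuous_on UNIV U" and [measurable]: "v \<in> borel_measurable borel"
    and int: "\<And>a b. set_integrable lborel {a..b} v"
    and eq: "\<And>x y. x \<le> y \<Longrightarrow> U y - U x = integral {x..y} v"
  shows "AE t in lborel. \<forall>\<alpha><1.
    (\<integral>\<^sup>+\<tau>\<in>{0<..1}. ennreal (\<bar>U (t - \<tau>) - U t\<bar> / \<tau> powr (1 + \<alpha>)) \<partial>lborel) < \<infinity>"
proof -
  have [measurable]: "U \<in> borel_measurable borel"
    by (rule borel_measurable_continuous_onI[OF cont])
  define I where "I \<alpha> t = (\<integral>\<^sup>+\<tau>\<in>{0<..1}. ennreal (\<bar>U (t - \<tau>) - U t\<bar> / \<tau> powr (1 + \<alpha>)) \<partial>lborel)" for \<alpha> t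
  have [measurable]: "I \<alpha> \<in> borel_measurable borel" for \<alpha> unfolding I_def by measurable
  have box: "AE t in lborel. t \<in> {- R..R} \<longrightarrow> I \<alpha> t \<noteq> \<infinity>" if "\<alpha> < 1" for \<alpha> R :: real
  proof -
    define K where "K = (\<integral>\<^sup>+s\<in>{- R - 1..R}. ennreal \<bar>v s\<bar> \<partial>lborel)"
    define G where "G t \<tau> = ennreal (\<bar>U (t - \<tau>) - U t\<bar> / \<tau> powr (1 + \<alpha>)) * indicator {0<..1} \<tau> * indicator {- R..R} t" for t \<tau>
    have G: "case_prod G \<in> borel_measurable (lborel \<Otimes>\<^sub>M lborel)"
      unfolding G_def by measurable
    have K: "K < \<infinity>"
    proof -
      have "K = ennreal (LINT s:{- R - 1..R}|lborel. \<bar>v s\<bar>)"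
        unfolding K_def by (rule nn_set_integral_eq_ennreal[OF set_integrable_abs[OF int]]) simp
      then show ?thesis by simp
    qed
    have "(\<integral>\<^sup>+t. I \<alpha> t * indicator {- R..R} t \<partial>lborel) = (\<integral>\<^sup>+t. (\<integral>\<^sup>+\<tau>. G t \<tau> \<partial>lborel) \<partial>lborel)"
      unfolding I_def G_def by (intro nn_integral_cong, subst nn_integral_multc) auto
    also have "\<dots> = (\<integral>\<^sup>+\<tau>. (\<integral>\<^sup>+t. G t \<tau> \<partial>lborel) \<partial>lborel)"
      by (rule lborel_pair.Fubini'[OF G, symmetric])
    also have "\<dots> \<le> (\<integral>\<^sup>+\<tau>. K * (ennreal (\<tau> powr (- \<alpha>)) * indicator {0<..1} \<tau>) \<partial>lborel)"
    proof (rule nn_integral_mono)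
      fix \<tau> :: real
      show "(\<integral>\<^sup>+t. G t \<tau> \<partial>lborel) \<le> K * (ennreal (\<tau> powr (- \<alpha>)) * indicator {0<..1} \<tau>)"
      proof (cases "\<tau> \<in> {0<..1}")
        case True
        have "(\<integral>\<^sup>+t. G t \<tau> \<partial>lborel) = (\<integral>\<^sup>+t. ennreal (\<tau> powr (- 1 - \<alpha>)) * (ennreal \<bar>U (t - \<tau>) - U t\<bar> * indicator {- R..R} t) \<partial>lborel)"
        proof (rule nn_integral_cong)
          fix t
          have "\<bar>U (t - \<tau>) - U t\<bar> / \<tau> powr (1 + \<alpha>) = \<tau> powr (- 1 - \<alpha>) * \<bar>U (t - \<tau>) - U t\<bar>"
            using powr_minus[of \<tau> "1 + \<alpha>"] by (simp add: divide_inverse)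
          then show "G t \<tau> = ennreal (\<tau> powr (- 1 - \<alpha>)) * (ennreal \<bar>U (t - \<tau>) - U t\<bar> * indicator {- R..R} t)"
            using True by (simp add: G_def ennreal_mult' mult.assoc)
        qed
        also have "\<dots> = ennreal (\<tau> powr (- 1 - \<alpha>)) * (\<integral>\<^sup>+t\<in>{- R..R}. ennreal \<bar>U (t - \<tau>) - U t\<bar> \<partial>lborel)"
          by (rule nn_integral_cmult) simp
        also have "\<dots> \<le> ennreal (\<tau> powr (- 1 - \<alpha>)) * (ennreal \<tau> * K)"
          unfolding K_def using True
          by (intro mult_left_mono local_increment_bound int eq) auto
        also have "\<dots> = K * ennreal (\<tau> powr (- 1 - \<alpha>) * \<tau> powr 1)"
          using True by (simp add: ennreal_mult' mult_ac)
        also have "\<tau> powr (- 1 - \<alpha>) * \<tau> powr 1 = \<tau> powr (- \<alpha>)"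
          unfolding powr_add[symmetric] by simp
        finally show ?thesis using True by simp
      qed (simp add: G_def)
    qed
    also have "\<dots> = K * ennreal (1 / (1 - \<alpha>))"
      using that by (subst nn_integral_cmult) (auto simp: nn_integral_powr_0_1)
    also have "\<dots> < \<infinity>" using K by (simp add: ennreal_mult_less_top)
    finally have "(\<integral>\<^sup>+t. I \<alpha> t * indicator {- R..R} t \<partial>lborel) \<noteq> \<infinity>" by simp
    then have "AE t in lborel. I \<alpha> t * indicator {- R..R} t \<noteq> \<infinity>"
      by (intro nn_integral_noteq_infinite) auto
    then show ?thesis by eventually_elim auto
  qed
  have "AE t in lborel. \<forall>n m. t \<in> {- real m..real m} \<longrightarrow> I (1 - 1 / real (Suc n)) t \<noteq> \<infinity>"
    unfolding AE_all_countable using box by simp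
  then show ?thesis
  proof eventually_elim
    case (elim t)
    show ?case
    proof safe
      fix \<alpha> :: real assume "\<alpha> < 1"
      then obtain n where n: "1 / real (Suc n) < 1 - \<alpha>"
        by (metis diff_gt_0_iff_gt nat_approx_posE)
      obtain m where "\<bar>t\<bar> \<le> real m" using real_arch_simple by blast
      with elim have "I (1 - 1 / real (Suc n)) t \<noteq> \<infinity>" by (auto simp: abs_le_iff)
      moreover have "I \<alpha> t \<le> I (1 - 1 / real (Suc n)) t"
        unfolding I_def
      proof (intro nn_integral_mono)
        fix \<tau> :: real
        have "\<tau> powr (1 + (1 - 1 / real (Suc n))) \<le> \<tau> powr (1 + \<alpha>)" if "\<tau> \<in> {0<..1}"
          using that n by (intro powr_mono') auto
        then show "ennreal (\<bar>U (t - \<tau>) - U t\<bar> / \<tau> powr (1 + \<alpha>)) * indicator {0<..1} \<tau>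
            \<le> ennreal (\<bar>U (t - \<tau>) - U t\<bar> / \<tau> powr (1 + (1 - 1 / real (Suc n)))) * indicator {0<..1} \<tau>"
          by (auto simp: indicator_def intro!: ennreal_leI divide_left_mono simp del: of_nat_Suc)
      qed
      ultimately have "I \<alpha> t < \<infinity>" using order_le_less_trans by (force simp: less_top)
      then show "(\<integral>\<^sup>+\<tau>\<in>{0<..1}. ennreal (\<bar>U (t - \<tau>) - U t\<bar> / \<tau> powr (1 + \<alpha>)) \<partial>lborel) < \<infinity>"
        unfolding I_def .
    qed
  qed
qed

section \<open>The pointwise estimate\<close>

text \<open>
  The functional equation, applied twice, exposes the two zeros of the reciprocal Gamma function at \<open>0\<close>
  and \<open>- 1\<close>; the remaining factor is continuous on the compact interval \<open>[1, 2]\<close>.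
\<close>

lemma inverse_Gamma_bound:
  obtains B :: real where "0 < B"
    "\<And>\<alpha>. 0 < \<alpha> \<Longrightarrow> \<alpha> < 1 \<Longrightarrow> \<bar>1 / Gamma (- \<alpha>)\<bar> \<le> B * (\<alpha> * (1 - \<alpha>))"
proof -
  have "bounded ((rGamma :: real \<Rightarrow> real) ` {1..2})"
    by (intro compact_imp_bounded compact_continuous_image continuous_on_rGamma) simp
  then obtain B where B: "0 < B" "\<forall>x\<in>{1..2::real}. \<bar>rGamma x\<bar> \<le> B"
    by (auto simp: bounded_pos)
  show thesis
  proof (rule that[OF B(1)])
    fix \<alpha> :: real assume \<alpha>: "0 < \<alpha>" "\<alpha> < 1"
    have "rGamma (- \<alpha>) = - \<alpha> * rGamma (1 - \<alpha>)"
      using rGamma_plus1[of "- \<alpha>"] by simp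
    also have "rGamma (1 - \<alpha>) = (1 - \<alpha>) * rGamma (2 - \<alpha>)"
      using rGamma_plus1[of "1 - \<alpha>"] by (simp add: algebra_simps)
    finally have "rGamma (- \<alpha>) = - \<alpha> * ((1 - \<alpha>) * rGamma (2 - \<alpha>))" .
    moreover have "1 / Gamma (- \<alpha>) = rGamma (- \<alpha>)"
      by (simp add: rGamma_inverse_Gamma inverse_eq_divide)
    ultimately have "\<bar>1 / Gamma (- \<alpha>)\<bar> = \<bar>rGamma (2 - \<alpha>)\<bar> * (\<alpha> * (1 - \<alpha>))"
      using \<alpha> by (simp add: abs_mult)
    also have "\<dots> \<le> B * (\<alpha> * (1 - \<alpha>))"
      using \<alpha> by (intro mult_right_mono B(2)[rule_format]) auto
    finally show "\<bar>1 / Gamma (- \<alpha>)\<bar> \<le> B * (\<alpha> * (1 - \<alpha>))" .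
  qed
qed

lemma maximal_minus_borel:
  assumes "AE x in lborel. f x = g x"
  shows "maximal_minus f t = (SUP h\<in>{0<..}. ennreal (1 / h) * (\<integral>\<^sup>+s\<in>{t - h..t}. ennreal \<bar>g s\<bar> \<partial>lborel))"
proof -
  have "(\<integral>\<^sup>+s\<in>{t - h..t}. ennreal \<bar>f s\<bar> \<partial>lebesgue) = (\<integral>\<^sup>+s\<in>{t - h..t}. ennreal \<bar>g s\<bar> \<partial>lborel)" for h
    unfolding nn_integral_completion
    by (rule nn_integral_cong_AE) (use assms in eventually_elim, simp)
  then show ?thesis by (simp add: maximal_minus_def)
qed

lemma average_le_maximal_minus:
  assumes "AE x in lborel. f x = g x" and "maximal_minus f t \<le> ennreal N" and "0 \<le> N" "0 < h"
  shows "(\<integral>\<^sup>+s\<in>{t - h..t}. ennreal \<bar>g s\<bar> \<partial>lborel) \<le> ennreal (N * h)"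
proof -
  have "ennreal (1 / h) * (\<integral>\<^sup>+s\<in>{t - h..t}. ennreal \<bar>g s\<bar> \<partial>lborel) \<le> ennreal N"
    using assms(2) unfolding maximal_minus_borel[OF assms(1)]
    by (rule order_trans[rotated]) (rule SUP_upper, use \<open>0 < h\<close> in auto)
  then have "ennreal h * (ennreal (1 / h) * (\<integral>\<^sup>+s\<in>{t - h..t}. ennreal \<bar>g s\<bar> \<partial>lborel)) \<le> ennreal h * ennreal N"
    by (rule mult_left_mono) simp
  then show ?thesis
    using \<open>0 < h\<close> \<open>0 \<le> N\<close>
    by (simp add: mult.assoc[symmetric] mult.commute[of N] flip: ennreal_mult')
qed

text \<open>
  If \<open>\<bar>U t\<bar>\<close> exceeded \<open>N\<close>, then by continuity so would the average of \<open>\<bar>U\<bar>\<close> over a short interval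
  to the left of \<open>t\<close>.
\<close>

lemma continuous_le_left_averages:
  fixes U :: "real \<Rightarrow> real"
  assumes cont: "continuous_on UNIV U"
    and avg: "\<And>h. 0 < h \<Longrightarrow> (\<integral>\<^sup>+s\<in>{t - h..t}. ennreal \<bar>U s\<bar> \<partial>lborel) \<le> ennreal (N * h)"
    and "0 \<le> N"
  shows "\<bar>U t\<bar> \<le> N"
proof (rule ccontr)
  assume "\<not> \<bar>U t\<bar> \<le> N"
  (* a level strictly between N and the value at t, so that the contradiction is strict *)
  define L where "L = (\<bar>U t\<bar> + N) / 2"
  have L: "N < L" "L < \<bar>U t\<bar>" using \<open>\<not> _\<close> by (auto simp: L_def)
  have "continuous_on UNIV (\<lambda>s. \<bar>U s\<bar>)" using cont by (intro continuous_intros)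
  then have "open ((\<lambda>s. \<bar>U s\<bar>) -` {L<..})" by (intro open_vimage) auto
  moreover have "t \<in> (\<lambda>s. \<bar>U s\<bar>) -` {L<..}" using L by simp
  ultimately obtain e where e: "0 < e" "cball t e \<subseteq> (\<lambda>s. \<bar>U s\<bar>) -` {L<..}"
    unfolding open_contains_cball by blast
  have "ennreal (L * e) = (\<integral>\<^sup>+s. ennreal L * indicator {t - e..t} s \<partial>lborel)"
    using e L \<open>0 \<le> N\<close> by (subst nn_integral_cmult_indicator) (auto simp: ennreal_mult')
  also have "\<dots> \<le> (\<integral>\<^sup>+s\<in>{t - e..t}. ennreal \<bar>U s\<bar> \<partial>lborel)"
  proof (intro nn_integral_mono)
    fix s
    have "L < \<bar>U s\<bar>" if "s \<in> {t - e..t}"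
      using that e by (auto simp: subset_iff dist_real_def)
    then show "ennreal L * indicator {t - e..t} s \<le> ennreal \<bar>U s\<bar> * indicator {t - e..t} s"
      by (auto simp: indicator_def intro!: ennreal_leI less_imp_le)
  qed
  also have "\<dots> \<le> ennreal (N * e)" by (rule avg[OF e(1)])
  finally have "L * e \<le> N * e" using e \<open>0 \<le> N\<close> by (subst (asm) ennreal_le_iff) auto
  then show False using L e by simp
qed

lemma tail_bound:
  fixes U :: "real \<Rightarrow> real"
  assumes [measurable]: "U \<in> borel_measurable borel" and "0 < \<alpha>" "0 \<le> K"
    and growth: "\<And>h. 1 \<le> h \<Longrightarrow> (\<integral>\<^sup>+s\<in>{t - h..t}. ennreal \<bar>U s\<bar> \<partial>lborel) \<le> ennreal (K * h)"
  shows "(\<integral>\<^sup>+\<tau>\<in>{1<..}. ennreal (\<bar>U (t - \<tau>) - U t\<bar> / \<tau> powr (1 + \<alpha>)) \<partial>lborel)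
    \<le> ennreal ((K * (1 + \<alpha>) + \<bar>U t\<bar>) / \<alpha>)"
proof -
  have "(\<integral>\<^sup>+\<tau>\<in>{1<..}. ennreal (\<bar>U (t - \<tau>) - U t\<bar> / \<tau> powr (1 + \<alpha>)) \<partial>lborel)
    \<le> (\<integral>\<^sup>+\<tau>. (ennreal (\<bar>U (t - \<tau>)\<bar> / \<tau> powr (1 + \<alpha>)) * indicator {1<..} \<tau> +
          ennreal \<bar>U t\<bar> * (ennreal (\<tau> powr (- 1 - \<alpha>)) * indicator {1..} \<tau>)) \<partial>lborel)"
  proof (rule nn_integral_mono)
    fix \<tau> :: real
    have "\<bar>U (t - \<tau>) - U t\<bar> / \<tau> powr (1 + \<alpha>) \<le> \<bar>U (t - \<tau>)\<bar> / \<tau> powr (1 + \<alpha>) + \<bar>U t\<bar> / \<tau> powr (1 + \<alpha>)"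
      unfolding add_divide_distrib[symmetric] by (intro divide_right_mono) auto
    also have "\<bar>U t\<bar> / \<tau> powr (1 + \<alpha>) = \<bar>U t\<bar> * \<tau> powr (- 1 - \<alpha>)"
      using powr_minus[of \<tau> "1 + \<alpha>"] by (simp add: divide_inverse)
    finally show "ennreal (\<bar>U (t - \<tau>) - U t\<bar> / \<tau> powr (1 + \<alpha>)) * indicator {1<..} \<tau>
        \<le> ennreal (\<bar>U (t - \<tau>)\<bar> / \<tau> powr (1 + \<alpha>)) * indicator {1<..} \<tau> +
          ennreal \<bar>U t\<bar> * (ennreal (\<tau> powr (- 1 - \<alpha>)) * indicator {1..} \<tau>)"
      by (auto simp: indicator_def ennreal_leI simp flip: ennreal_plus ennreal_mult')
  qed
  also have "\<dots> = (\<integral>\<^sup>+\<tau>\<in>{1<..}. ennreal (\<bar>U (t - \<tau>)\<bar> / \<tau> powr (1 + \<alpha>)) \<partial>lborel) + ennreal \<bar>U t\<bar> * ennreal (1 / \<alpha>)"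
    using \<open>0 < \<alpha>\<close> by (subst nn_integral_add) (auto simp: nn_integral_cmult nn_integral_powr_atLeast)
  also have "\<dots> \<le> ennreal (K * (1 + \<alpha>) / \<alpha>) + ennreal (\<bar>U t\<bar> / \<alpha>)"
    using power_tail_bound[OF _ \<open>0 < \<alpha>\<close> \<open>0 \<le> K\<close> growth]
    by (intro add_mono) (auto simp flip: ennreal_mult')
  also have "\<dots> = ennreal ((K * (1 + \<alpha>) + \<bar>U t\<bar>) / \<alpha>)"
    using \<open>0 < \<alpha>\<close> \<open>0 \<le> K\<close> by (simp add: add_divide_distrib flip: ennreal_plus)
  finally show ?thesis .
qed

lemma near_zero_bound:
  fixes U :: "real \<Rightarrow> real"
  assumes "\<alpha> < 1" "0 \<le> M"
    and lip: "\<And>\<tau>. 0 < \<tau> \<Longrightarrow> \<bar>U (t - \<tau>) - U t\<bar> \<le> M * \<tau>"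
  shows "(\<integral>\<^sup>+\<tau>\<in>{0<..1}. ennreal (\<bar>U (t - \<tau>) - U t\<bar> / \<tau> powr (1 + \<alpha>)) \<partial>lborel) \<le> ennreal (M / (1 - \<alpha>))"
proof -
  have "(\<integral>\<^sup>+\<tau>\<in>{0<..1}. ennreal (\<bar>U (t - \<tau>) - U t\<bar> / \<tau> powr (1 + \<alpha>)) \<partial>lborel)
      \<le> (\<integral>\<^sup>+\<tau>. ennreal M * (ennreal (\<tau> powr (- \<alpha>)) * indicator {0<..1} \<tau>) \<partial>lborel)"
  proof (rule nn_integral_mono)
    fix \<tau> :: real
    have "\<bar>U (t - \<tau>) - U t\<bar> / \<tau> powr (1 + \<alpha>) \<le> M * \<tau> powr (- \<alpha>)" if "0 < \<tau>"
      using lip[OF that] that by (simp add: powr_add powr_minus divide_simps)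
    then show "ennreal (\<bar>U (t - \<tau>) - U t\<bar> / \<tau> powr (1 + \<alpha>)) * indicator {0<..1} \<tau>
        \<le> ennreal M * (ennreal (\<tau> powr (- \<alpha>)) * indicator {0<..1} \<tau>)"
      using \<open>0 \<le> M\<close> by (auto simp: indicator_def ennreal_leI simp flip: ennreal_mult')
  qed
  also have "\<dots> = ennreal (M / (1 - \<alpha>))"
    using assms by (subst nn_integral_cmult) (auto simp: nn_integral_powr_0_1 simp flip: ennreal_mult')
  finally show ?thesis .
qed

text \<open>
  At a fixed \<open>t\<close> this allows passing from \<open>u\<close> to its continuous representative inside the integral
  over \<open>\<tau>\<close>.
\<close>

lemma negligible_reflect:
  assumes "AE x in lborel. u x = U x"
  shows "negligible {\<tau>. u (t - \<tau>) \<noteq> U (t - (\<tau> :: real))}"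
proof -
  from assms obtain N where N: "N \<in> null_sets lborel" "{x. u x \<noteq> U x} \<subseteq> N"
    by (auto simp: eventually_ae_filter)
  have "AE x in lborel. x \<notin> N" by (rule AE_not_in[OF N(1)])
  then have "AE x in lborel. t + (-1) * x \<notin> N"
    using N(1) by (intro AE_borel_affine) auto
  then have "AE \<tau> in lborel. \<tau> \<notin> {\<tau>. u (t - \<tau>) \<noteq> U (t - \<tau>)}"
    by eventually_elim (use N(2) in auto)
  then have "AE \<tau> in lebesgue. \<tau> \<notin> {\<tau>. u (t - \<tau>) \<noteq> U (t - \<tau>)}"
    by (rule AE_completion)
  then obtain N' where "N' \<in> null_sets lebesgue" "{\<tau>. u (t - \<tau>) \<noteq> U (t - \<tau>)} \<subseteq> N'"
    by (auto simp: eventually_ae_filter)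
  then show ?thesis
    by (metis negligible_iff_null_sets negligible_subset)
qed

lemma nn_integral_split_at_1:
  fixes g :: "real \<Rightarrow> ennreal"
  assumes [measurable]: "g \<in> borel_measurable borel"
  shows "(\<integral>\<^sup>+\<tau>\<in>{0<..}. g \<tau> \<partial>lborel) = (\<integral>\<^sup>+\<tau>\<in>{0<..1}. g \<tau> \<partial>lborel) + (\<integral>\<^sup>+\<tau>\<in>{1<..}. g \<tau> \<partial>lborel)"
proof -
  have "(\<integral>\<^sup>+\<tau>\<in>{0<..}. g \<tau> \<partial>lborel) = (\<integral>\<^sup>+\<tau>\<in>{0<..1} \<union> {1<..}. g \<tau> \<partial>lborel)"
    by (intro nn_integral_cong) (auto simp: indicator_def)
  also have "\<dots> = (\<integral>\<^sup>+\<tau>\<in>{0<..1}. g \<tau> \<partial>lborel) + (\<integral>\<^sup>+\<tau>\<in>{1<..}. g \<tau> \<partial>lborel)"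
    by (rule nn_integral_disjoint_pair) auto
  finally show ?thesis .
qed

lemma pointwise_estimate:
  fixes U v :: "real \<Rightarrow> real"
  assumes cont: "continuous_on UNIV U"
    and int: "\<And>a b. set_integrable lborel {a..b} v"
    and eq: "\<And>x y. x \<le> y \<Longrightarrow> U y - U x = integral {x..y} v"
    and "0 \<le> M" "0 \<le> N" "0 < \<alpha>" "\<alpha> < 1"
    and M: "\<And>h. 0 < h \<Longrightarrow> (\<integral>\<^sup>+s\<in>{t - h..t}. ennreal \<bar>v s\<bar> \<partial>lborel) \<le> ennreal (M * h)"
    and N: "\<And>h. 0 < h \<Longrightarrow> (\<integral>\<^sup>+s\<in>{t - h..t}. ennreal \<bar>U s\<bar> \<partial>lborel) \<le> ennreal (N * h)"
  shows "(\<integral>\<^sup>+\<tau>\<in>{0<..}. ennreal (\<bar>U (t - \<tau>) - U t\<bar> / \<tau> powr (1 + \<alpha>)) \<partial>lborel)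
    \<le> ennreal (M / (1 - \<alpha>) + N * (2 + \<alpha>) / \<alpha>)"
proof -
  have [measurable]: "U \<in> borel_measurable borel"
    by (rule borel_measurable_continuous_onI[OF cont])
  have lip: "\<bar>U (t - \<tau>) - U t\<bar> \<le> M * \<tau>" if "0 < \<tau>" for \<tau>
  proof -
    have "ennreal \<bar>U (t - \<tau>) - U t\<bar> \<le> ennreal (M * \<tau>)"
      using abs_increment_le[where x = "t - \<tau>" and y = t, OF int eq] M[OF that] that by auto
    then show ?thesis using \<open>0 \<le> M\<close> that by (subst (asm) ennreal_le_iff) auto
  qed
  have "(\<integral>\<^sup>+\<tau>\<in>{0<..}. ennreal (\<bar>U (t - \<tau>) - U t\<bar> / \<tau> powr (1 + \<alpha>)) \<partial>lborel)
    = (\<integral>\<^sup>+\<tau>\<in>{0<..1}. ennreal (\<bar>U (t - \<tau>) - U t\<bar> / \<tau> powr (1 + \<alpha>)) \<partial>lborel)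
    + (\<integral>\<^sup>+\<tau>\<in>{1<..}. ennreal (\<bar>U (t - \<tau>) - U t\<bar> / \<tau> powr (1 + \<alpha>)) \<partial>lborel)"
    by (rule nn_integral_split_at_1) measurable
  also have "\<dots> \<le> ennreal (M / (1 - \<alpha>)) + ennreal ((N * (1 + \<alpha>) + \<bar>U t\<bar>) / \<alpha>)"
    using assms by (intro add_mono near_zero_bound lip tail_bound) auto
  also have "\<dots> \<le> ennreal (M / (1 - \<alpha>)) + ennreal (N * (2 + \<alpha>) / \<alpha>)"
    using continuous_le_left_averages[OF cont N \<open>0 \<le> N\<close>] \<open>0 < \<alpha>\<close>
    by (intro add_left_mono ennreal_leI divide_right_mono) (auto simp: algebra_simps)
  also have "\<dots> = ennreal (M / (1 - \<alpha>) + N * (2 + \<alpha>) / \<alpha>)"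
    using assms by (simp flip: ennreal_plus)
  finally show ?thesis .
qed

theorem theorem2p10:
  shows "\<exists>C>0. \<forall>p\<ge>1. \<forall>\<omega>\<in>sawyer_minus p. \<forall>u\<in>weighted_W1p p \<omega>.
    \<forall>u'. distributional_derivative u u' \<longrightarrow>
      (AE t in lebesgue.
         (\<forall>\<alpha>\<in>{0<..<1}.
            (\<lambda>\<tau>. (u (t - \<tau>) - u t) / \<tau> powr (1 + \<alpha>)) absolutely_integrable_on {0<..}) \<and>
         (SUP \<alpha>\<in>{0<..<1}.
            ennreal \<bar>1 / Gamma (- \<alpha>) *
              (LINT \<tau>:{0<..}|lebesgue. (u (t - \<tau>) - u t) / \<tau> powr (1 + \<alpha>))\<bar>)
           \<le> ennreal C * (maximal_minus u' t + maximal_minus u t))"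
proof -
  obtain B :: real where B: "0 < B"
    "\<And>\<alpha>. 0 < \<alpha> \<Longrightarrow> \<alpha> < 1 \<Longrightarrow> \<bar>1 / Gamma (- \<alpha>)\<bar> \<le> B * (\<alpha> * (1 - \<alpha>))"
    using inverse_Gamma_bound by blast
  show ?thesis
  proof (intro exI[of _ "2 * B"] conjI allI impI ballI)
    show "0 < 2 * B" using B by simp
    fix p :: real and \<omega> u u'
    assume p: "1 \<le> p" and \<omega>: "\<omega> \<in> sawyer_minus p" and u: "u \<in> weighted_W1p p \<omega>"
      and "distributional_derivative u u'"
    from continuous_representative[OF this(4)] obtain U v where cont: "continuous_on UNIV U"
      and [measurable]: "v \<in> borel_measurable borel"
      and aeU: "AE x in lborel. u x = U x" and aev: "AE x in lborel. u' x = v x"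
      and int: "\<And>a b. set_integrable lborel {a..b} v"
      and eq: "\<And>x y. x \<le> y \<Longrightarrow> U y - U x = integral {x..y} v" by blast
    have [measurable]: "U \<in> borel_measurable borel"
      by (rule borel_measurable_continuous_onI[OF cont])
    have uLp: "u \<in> weighted_Lp p \<omega>" using u by (simp add: weighted_W1p_def)
    show "AE t in lebesgue.
         (\<forall>\<alpha>\<in>{0<..<1}.
            (\<lambda>\<tau>. (u (t - \<tau>) - u t) / \<tau> powr (1 + \<alpha>)) absolutely_integrable_on {0<..}) \<and>
         (SUP \<alpha>\<in>{0<..<1}.
            ennreal \<bar>1 / Gamma (- \<alpha>) *
              (LINT \<tau>:{0<..}|lebesgue. (u (t - \<tau>) - u t) / \<tau> powr (1 + \<alpha>))\<bar>)
           \<le> ennreal (2 * B) * (maximal_minus u' t + maximal_minus u t)"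
      using AE_completion[OF aeU] AE_completion[OF AE_near_zero_finite[OF cont _ int eq], simplified]
    proof eventually_elim
      case (elim t)
      define F where "F \<alpha> \<tau> = (U (t - \<tau>) - U t) / \<tau> powr (1 + \<alpha>)" for \<alpha> \<tau>
      define f where "f \<alpha> \<tau> = (u (t - \<tau>) - u t) / \<tau> powr (1 + \<alpha>)" for \<alpha> \<tau>
      have [measurable]: "F \<alpha> \<in> borel_measurable borel" for \<alpha> unfolding F_def by measurable
      have fF: "f \<alpha> \<tau> = F \<alpha> \<tau>" if "\<tau> \<in> {0<..} - {\<tau>. u (t - \<tau>) \<noteq> U (t - \<tau>)}" for \<alpha> \<tau>
        using that elim(1) by (simp add: f_def F_def)
      note neg = negligible_reflect[OF aeU, of t]
      from weighted_Lp_linear_growth[OF p \<omega> uLp, of t] obtain K where "0 \<le> K"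
        and Ku: "\<And>h. 1 \<le> h \<Longrightarrow> (\<integral>\<^sup>+\<tau>\<in>{t - h..t}. ennreal \<bar>u \<tau>\<bar> \<partial>lebesgue) \<le> ennreal (K * h)" by blast
      have K: "(\<integral>\<^sup>+s\<in>{t - h..t}. ennreal \<bar>U s\<bar> \<partial>lborel) \<le> ennreal (K * h)" if "1 \<le> h" for h
      proof -
        have "(\<integral>\<^sup>+s\<in>{t - h..t}. ennreal \<bar>U s\<bar> \<partial>lborel) = (\<integral>\<^sup>+s\<in>{t - h..t}. ennreal \<bar>u s\<bar> \<partial>lborel)"
          by (rule nn_integral_cong_AE) (use aeU in eventually_elim, simp)
        then show ?thesis using Ku[OF that] by (simp add: nn_integral_completion)
      qed
      have absF: "norm (indicator {0<..} \<tau> *\<^sub>R F \<alpha> \<tau>) = \<bar>U (t - \<tau>) - U t\<bar> / \<tau> powr (1 + \<alpha>) * indicator {0<..} \<tau>" for \<alpha> \<tau>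
        by (simp add: F_def indicator_def)
      have intF: "set_integrable lborel {0<..} (F \<alpha>)" if \<alpha>: "\<alpha> \<in> {0<..<1}" for \<alpha>
        unfolding set_integrable_def
      proof (rule integrableI_bounded)
        have "(\<integral>\<^sup>+\<tau>. ennreal (norm (indicator {0<..} \<tau> *\<^sub>R F \<alpha> \<tau>)) \<partial>lborel)
          = (\<integral>\<^sup>+\<tau>\<in>{0<..}. ennreal (\<bar>U (t - \<tau>) - U t\<bar> / \<tau> powr (1 + \<alpha>)) \<partial>lborel)"
          unfolding absF by (intro nn_integral_cong) (auto simp: indicator_def)
        also have "\<dots> = (\<integral>\<^sup>+\<tau>\<in>{0<..1}. ennreal (\<bar>U (t - \<tau>) - U t\<bar> / \<tau> powr (1 + \<alpha>)) \<partial>lborel)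
          + (\<integral>\<^sup>+\<tau>\<in>{1<..}. ennreal (\<bar>U (t - \<tau>) - U t\<bar> / \<tau> powr (1 + \<alpha>)) \<partial>lborel)"
          by (rule nn_integral_split_at_1) measurable
        also have "\<dots> < \<infinity>"
        proof -
          have "(\<integral>\<^sup>+\<tau>\<in>{1<..}. ennreal (\<bar>U (t - \<tau>) - U t\<bar> / \<tau> powr (1 + \<alpha>)) \<partial>lborel) < \<infinity>"
            by (rule le_less_trans[OF tail_bound[OF _ _ \<open>0 \<le> K\<close> K]]) (use \<alpha> in auto)
          then show ?thesis using elim(2) \<alpha> by simp
        qed
        finally show "(\<integral>\<^sup>+\<tau>. ennreal (norm (indicator {0<..} \<tau> *\<^sub>R F \<alpha> \<tau>)) \<partial>lborel) < \<infinity>" .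
      qed simp
      have intF': "F \<alpha> absolutely_integrable_on {0<..}" if "\<alpha> \<in> {0<..<1}" for \<alpha>
        using intF[OF that] by (simp add: set_integrable_def integrable_completion)
      have intf: "f \<alpha> absolutely_integrable_on {0<..}" if "\<alpha> \<in> {0<..<1}" for \<alpha>
        by (rule absolutely_integrable_spike[OF intF'[OF that] neg fF])
      have eqI: "(LINT \<tau>:{0<..}|lebesgue. f \<alpha> \<tau>) = (LINT \<tau>:{0<..}|lborel. F \<alpha> \<tau>)" if \<alpha>: "\<alpha> \<in> {0<..<1}" for \<alpha>
      proof -
        have "(LINT \<tau>:{0<..}|lebesgue. f \<alpha> \<tau>) = integral {0<..} (f \<alpha>)"
          by (rule set_lebesgue_integral_eq_integral(2)[OF intf[OF \<alpha>]])
        also have "\<dots> = integral {0<..} (F \<alpha>)"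
          by (rule integral_spike[OF neg]) (use fF in simp)
        also have "\<dots> = (LINT \<tau>:{0<..}|lborel. F \<alpha> \<tau>)"
          by (rule set_borel_integral_eq_integral(2)[OF intF[OF \<alpha>], symmetric])
        finally show ?thesis .
      qed
      have "ennreal \<bar>1 / Gamma (- \<alpha>) * (LINT \<tau>:{0<..}|lebesgue. f \<alpha> \<tau>)\<bar>
          \<le> ennreal (2 * B) * (maximal_minus u' t + maximal_minus u t)" if "\<alpha> \<in> {0<..<1}" for \<alpha>
      proof (cases "maximal_minus u' t + maximal_minus u t = \<infinity>")
        case True
        have "ennreal (2 * B) * (maximal_minus u' t + maximal_minus u t) = top"
          unfolding True using B by (simp add: ennreal_mult_top)
        then show ?thesis by (simp only: top_greatest)
      next
        case False
        then obtain M N where M: "maximal_minus u' t = ennreal M" "0 \<le> M"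
          and N: "maximal_minus u t = ennreal N" "0 \<le> N"
          by (cases "maximal_minus u' t"; cases "maximal_minus u t") auto
        have \<alpha>: "0 < \<alpha>" "\<alpha> < 1" using that by auto
        have "ennreal \<bar>LINT \<tau>:{0<..}|lborel. F \<alpha> \<tau>\<bar>
            \<le> (\<integral>\<^sup>+\<tau>. ennreal (norm (indicator {0<..} \<tau> *\<^sub>R F \<alpha> \<tau>)) \<partial>lborel)"
          using integral_norm_bound_ennreal[OF intF[OF that, unfolded set_integrable_def]]
          by (simp add: set_lebesgue_integral_def)
        also have "\<dots> = (\<integral>\<^sup>+\<tau>\<in>{0<..}. ennreal (\<bar>U (t - \<tau>) - U t\<bar> / \<tau> powr (1 + \<alpha>)) \<partial>lborel)"
          unfolding absF by (intro nn_integral_cong) (auto simp: indicator_def)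
        also have "\<dots> \<le> ennreal (M / (1 - \<alpha>) + N * (2 + \<alpha>) / \<alpha>)"
          by (rule pointwise_estimate[OF cont int eq])
            (use \<alpha> M N average_le_maximal_minus[OF aev] average_le_maximal_minus[OF aeU] in auto)
        finally have I: "\<bar>LINT \<tau>:{0<..}|lborel. F \<alpha> \<tau>\<bar> \<le> M / (1 - \<alpha>) + N * (2 + \<alpha>) / \<alpha>"
          using \<alpha> M N by (subst (asm) ennreal_le_iff) auto
        have "\<bar>1 / Gamma (- \<alpha>) * (LINT \<tau>:{0<..}|lborel. F \<alpha> \<tau>)\<bar>
            \<le> (B * (\<alpha> * (1 - \<alpha>))) * (M / (1 - \<alpha>) + N * (2 + \<alpha>) / \<alpha>)"
          unfolding abs_mult using \<alpha> B by (intro mult_mono B(2) I) auto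
        also have "\<dots> = B * (\<alpha> * M + (1 - \<alpha>) * (2 + \<alpha>) * N)"
          using \<alpha> by (simp add: field_simps)
        also have "\<dots> \<le> B * (2 * M + 2 * N)"
        proof -
          have "(1 - \<alpha>) * (2 + \<alpha>) \<le> 2" using \<alpha> by (simp add: algebra_simps)
          then show ?thesis
            using \<alpha> B M N by (intro mult_left_mono add_mono mult_right_mono) auto
        qed
        finally have "\<bar>1 / Gamma (- \<alpha>) * (LINT \<tau>:{0<..}|lborel. F \<alpha> \<tau>)\<bar> \<le> 2 * B * (M + N)"
          by (simp add: algebra_simps)
        then have "ennreal \<bar>1 / Gamma (- \<alpha>) * (LINT \<tau>:{0<..}|lborel. F \<alpha> \<tau>)\<bar> \<le> ennreal (2 * B) * (ennreal M + ennreal N)"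
          using B M N by (simp add: ennreal_leI flip: ennreal_plus ennreal_mult)
        then show ?thesis unfolding eqI[OF that] M N .
      qed
      then have "(SUP \<alpha>\<in>{0<..<1}. ennreal \<bar>1 / Gamma (- \<alpha>) * (LINT \<tau>:{0<..}|lebesgue. f \<alpha> \<tau>)\<bar>)
          \<le> ennreal (2 * B) * (maximal_minus u' t + maximal_minus u t)"
        by (rule SUP_least)
      with intf show ?case unfolding f_def by blast
    qed
  qed
qed

end
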